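(* Let $\ell,T>0$ and let $P,Q\in C^1[0,\ell]$ be real-valued functions. Let $u,\widetilde{u}\in C^{1,2}([0,T]\times[0,\ell])$ satisfy $$\partial_tu=\partial_x^2u-P(x)u,\qquad \partial_xu(t,0)=0,\qquad 0<x<\ell,\ 0<t<T,$$ $$\partial_t\widetilde{u}=\partial_x^2\widetilde{u}-Q(x)\widetilde{u},\qquad \partial_x\widetilde{u}(t,0)=0,\qquad 0<x<\ell,\ 0<t<T,$$ and suppose that there is $a\in\mathcal{A}$ such that either $u(0,\cdot)=\widetilde{u}(0,\cdot)=a$ or $u(T,\cdot)=\widetilde{u}(T,\cdot)=a$. If $u(t,0)=\widetilde{u}(t,0)$ for all $t\in(0,T)$, then $P=Q$ on $[0,\ell]$.
   Context: $C^{1,2}([0,T]\times[0,\ell])$ denotes the set of $u\in C([0,T]\times[0,\ell])$ such that $\partial_tu,\partial_xu,\partial_x^2u\in C([0,T]\times[0,\ell])$; here the functions $u,\widetilde u$ are real-valued. $\mathcal{A}:=\{a\in H^3(0,\ell):\ a'(0)=0,\ a>0\text{ on }[0,\ell]\}$, where $H^3(0,\ell)$ is the usual Sobolev space and $a'=\frac{da}{dx}$. *)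

theory Defs
  imports "HOL-Analysis.Analysis"
begin

text \<open>
  Functions on a closed interval \<open>[0,L]\<close> are total functions on the reals whose values outside
  the interval play no role; hence derivatives are taken within the interval, so that they are
  one-sided at its end points.
\<close>

abbreviation D_within :: "real set \<Rightarrow> (real \<Rightarrow> real) \<Rightarrow> real \<Rightarrow> real" where
  "D_within S f x \<equiv> vector_derivative f (at x within S)"

definition C1_on :: "real set \<Rightarrow> (real \<Rightarrow> real) set" where
  "C1_on S = {f. (\<forall>x\<in>S. f differentiable (at x within S)) \<and> continuous_on S (D_within S f)}"

definition dt :: "real \<Rightarrow> (real \<Rightarrow> real \<Rightarrow> real) \<Rightarrow> real \<Rightarrow> real \<Rightarrow> real" where
  "dt T u t x = D_within {0..T} (\<lambda>s. u s x) t"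

definition dx :: "real \<Rightarrow> (real \<Rightarrow> real \<Rightarrow> real) \<Rightarrow> real \<Rightarrow> real \<Rightarrow> real" where
  "dx L u t x = D_within {0..L} (u t) x"

text \<open>Differentiability is required explicitly, since \<^const>\<open>vector_derivative\<close> is total.\<close>

definition C12 :: "real \<Rightarrow> real \<Rightarrow> (real \<Rightarrow> real \<Rightarrow> real) set" where
  "C12 T L = {u.
     (\<forall>t\<in>{0..T}. \<forall>x\<in>{0..L}.
        (\<lambda>s. u s x) differentiable (at t within {0..T}) \<and>
        u t differentiable (at x within {0..L}) \<and>
        dx L u t differentiable (at x within {0..L})) \<and>
     continuous_on ({0..T} \<times> {0..L}) (\<lambda>(t, x). u t x) \<and>
     continuous_on ({0..T} \<times> {0..L}) (\<lambda>(t, x). dt T u t x) \<and>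
     continuous_on ({0..T} \<times> {0..L}) (\<lambda>(t, x). dx L u t x) \<and>
     continuous_on ({0..T} \<times> {0..L}) (\<lambda>(t, x). dx L (dx L u) t x)}"

definition test_functions :: "real \<Rightarrow> real \<Rightarrow> (real \<Rightarrow> real) set" where
  "test_functions a b = {\<phi>.
     (\<forall>n x. ((deriv ^^ n) \<phi>) differentiable (at x)) \<and>
     (\<exists>c d. a < c \<and> d < b \<and> (\<forall>x. x \<notin> {c..d} \<longrightarrow> \<phi> x = 0))}"

definition L2 :: "real \<Rightarrow> real \<Rightarrow> (real \<Rightarrow> real) set" where
  "L2 a b = {f. f \<in> borel_measurable (lebesgue_on {a<..<b}) \<and>
                integrable (lebesgue_on {a<..<b}) (\<lambda>x. (f x)\<^sup>2)}"

definition weak_deriv :: "real \<Rightarrow> real \<Rightarrow> nat \<Rightarrow> (real \<Rightarrow> real) \<Rightarrow> (real \<Rightarrow> real) \<Rightarrow> bool" where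
  "weak_deriv a b j f g \<longleftrightarrow> (\<forall>\<phi>\<in>test_functions a b.
     integral\<^sup>L (lebesgue_on {a<..<b}) (\<lambda>x. f x * (deriv ^^ j) \<phi> x) =
     (-1) ^ j * integral\<^sup>L (lebesgue_on {a<..<b}) (\<lambda>x. g x * \<phi> x))"

definition sobolev_H :: "nat \<Rightarrow> real \<Rightarrow> real \<Rightarrow> (real \<Rightarrow> real) set" where
  "sobolev_H k a b = {f \<in> L2 a b. \<forall>j\<in>{1..k}. \<exists>g\<in>L2 a b. weak_deriv a b j f g}"

text \<open>
  Membership in \<^const>\<open>sobolev_H\<close> only depends on the almost-everywhere class. Pointwise
  conditions refer to the representative that is continuous on \<open>[0,L]\<close>; for \<open>k = 3\<close> it is
  \<open>C\<^sup>2\<close> up to the boundary, so its one-sided derivative at 0 is the value of the weak derivative.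
\<close>

definition A_class :: "real \<Rightarrow> (real \<Rightarrow> real) set" where
  "A_class L = {a \<in> sobolev_H 3 0 L. continuous_on {0..L} a \<and>
     (a has_real_derivative 0) (at 0 within {0..L}) \<and> (\<forall>x\<in>{0..L}. a x > 0)}"

end

theory Submission imports Defs begin

text \<open>
  The transmutation operator of a potential \<open>P\<close> sends \<open>f\<close> to the trace \<open>X\<^sub>P f (x) = W (x, 0)\<close> of the
  solution of \<open>W\<^sub>x\<^sub>x = W\<^sub>y\<^sub>y - P (y) W\<close> with \<open>W (0, y) = f (y)\<close> and \<open>W\<^sub>x (0, y) = 0\<close>, everything extended evenly
  in \<open>y\<close>. It satisfies \<open>(X\<^sub>P f)'' = X\<^sub>P (f'' - P f)\<close> for \<open>f' (0) = 0\<close>, so \<open>X\<^sub>P u\<close> and \<open>X\<^sub>Q v\<close> both solve the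
  free heat equation, with the same Cauchy data at \<open>x = 0\<close>. Hence they coincide: the truncated Laplace
  transform in time of their difference solves \<open>V'' = s V - b + O (exp (- s \<delta>))\<close> with zero Cauchy data and
  stays bounded as \<open>s\<close> tends to infinity, which forces \<open>b = 0\<close> by an argument of Mikusinski.
  At the time where \<open>u = v = a\<close> this gives \<open>X\<^sub>P a = X\<^sub>Q a\<close>. Differentiating twice, \<open>X\<^sub>P g - X\<^sub>Q g = X\<^sub>Q ((P - Q) a)\<close>
  for \<open>g = a'' - P a\<close>. Since \<open>X\<^sub>Q\<close> is the identity plus a Volterra operator and \<open>X\<^sub>P - X\<^sub>Q\<close> is controlled
  by the integral of \<open>\<bar>P - Q\<bar>\<close> over \<open>[0, x]\<close>, Gronwall's inequality yields \<open>P = Q\<close>.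
\<close>

section \<open>Integrals along lines\<close>

text \<open>The obstacle is that the Cauchy problem in x is ill-posed for the heat equation. With s
  = n^2 the kernel of the free problem is sinh (n (L - r)), whose growth exp (n L) is beaten by the
  factor exp (- n^2 \<delta>) on the term left over at the final time. What remains is a bound of
  order n on exponential moments of b, and this already forces b = 0. Here \<delta> = T -
  \<open>t\<^sub>1\<close> must be positive, so times before T come first and T follows by
  continuity; this lets both alternatives for a be treated alike. W is handled only as a continuous
  solution of an integral equation. Its second x-derivative is reached by integrating twice in x and
  invoking uniqueness, so no derivative of W in y is ever taken. Similarly the Laplace transform is
  taken before the transmutation, so X_P u never has to be differentiated in t. Positivity of a
  enters at the very end, where a bound on (P - Q) a has to become one on P - Q.\<close>

abbreviation jcont :: "(real \<Rightarrow> real \<Rightarrow> real) \<Rightarrow> bool" where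
  "jcont F \<equiv> continuous_on UNIV (\<lambda>(x, y). F x y)"

lemma jcont_compose:
  assumes "jcont F" "continuous_on S g" "continuous_on S h"
  shows "continuous_on S (\<lambda>p. F (g p) (h p))"
proof -
  have "continuous_on S (\<lambda>p. (\<lambda>(x, y). F x y) (g p, h p))"
    by (rule continuous_on_compose2[OF assms(1)]) (auto intro!: continuous_intros assms)
  then show ?thesis by simp
qed

text \<open>Fubini on the triangle s, r >= 0, s + r <= x. Cutting off by the indicator of this
  compact set makes the integrand integrable over the plane, and the set is symmetric in s and
  r.\<close>

lemma integral_triangle_swap:
  assumes G: "jcont G"
  shows "integral {0..x} (\<lambda>s. integral {0..x - s} (\<lambda>r. G s r))
       = integral {0..x} (\<lambda>r. integral {0..x - r} (\<lambda>s. G s r))"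
proof -
  define S where "S = {(s::real, r::real). 0 \<le> s \<and> 0 \<le> r \<and> s + r \<le> x}"
  have "closed S"
    unfolding S_def case_prod_unfold
    by (intro closed_Collect_conj closed_Collect_le continuous_intros)
  moreover have "S \<subseteq> {0..x} \<times> {0..x}" unfolding S_def by auto
  then have "bounded S"
    by (rule bounded_subset[rotated]) (intro bounded_Times bounded_closed_interval)
  ultimately have cS: "compact S" by (simp add: compact_eq_bounded_closed)
  define f where "f s r = indicator S (s, r) *\<^sub>R G s r" for s r
  have "integrable lborel (\<lambda>p. indicator S p *\<^sub>R (case p of (s, r) \<Rightarrow> G s r))"
    by (rule borel_integrable_compact[OF cS]) (rule continuous_on_subset[OF G], simp)
  then have int: "integrable (lborel \<Otimes>\<^sub>M lborel) (\<lambda>(s, r). f s r)"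
    unfolding lborel_prod f_def by (simp add: case_prod_unfold)
  have swap: "(\<integral>r. (\<integral>s. f s r \<partial>lborel) \<partial>lborel) = (\<integral>s. (\<integral>r. f s r \<partial>lborel) \<partial>lborel)"
    by (rule lborel_pair.Fubini_integral[OF int])
  have leb: "(\<integral>t. indicator {a..b} t *\<^sub>R h t \<partial>lborel) = integral {a..b} h"
    if "continuous_on {a..b} h" for h :: "real \<Rightarrow> real" and a b
    using set_borel_integral_eq_integral(2)[of "{a..b}" h] borel_integrable_atLeastAtMost'[OF that]
    by (simp add: set_lebesgue_integral_def)
  \<comment> \<open>Rescaling r = (x - s) q moves the variable endpoint to the fixed interval
    [0, 1]. The outer integrand must be continuous for \<open>leb\<close> to apply to it.\<close>
  have param: "continuous_on {0..x} (\<lambda>s. integral {0..x - s} (\<lambda>r. H s r))" if H: "jcont H" for H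
  proof -
    have eq: "integral {0..x - s} (\<lambda>r. H s r) = (x - s) * integral {0..1} (\<lambda>q. H s ((x - s) * q))"
      if "s \<in> {0..x}" for s
    proof -
      have "((\<lambda>q. (x - s) *\<^sub>R H s ((x - s) * q)) has_integral
          (integral {(x - s) * 0..(x - s) * 1} (H s))) {0..1}"
        by (rule has_integral_substitution[where c = 0 and d = "x - s"])
          (use that in \<open>auto intro!: derivative_eq_intros jcont_compose[OF H] continuous_intros
             simp: mult_left_le\<close>)
      then have "integral {0..1} (\<lambda>q. (x - s) * H s ((x - s) * q)) = integral {0..x - s} (H s)"
        by (auto simp: has_integral_iff)
      then show ?thesis by simp
    qed
    have "continuous_on {0..x} (\<lambda>s. integral (cbox 0 1) (\<lambda>q. H s ((x - s) * q)))"
      by (rule integral_continuous_on_param)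
        (auto simp: case_prod_unfold intro!: jcont_compose[OF H] continuous_intros)
    then have "continuous_on {0..x} (\<lambda>s. (x - s) * integral {0..1} (\<lambda>q. H s ((x - s) * q)))"
      by (auto intro!: continuous_intros)
    then show ?thesis by (rule continuous_on_eq) (simp add: eq)
  qed
  have iter: "(\<integral>s. (\<integral>r. indicator S (s, r) *\<^sub>R H s r \<partial>lborel) \<partial>lborel)
      = integral {0..x} (\<lambda>s. integral {0..x - s} (\<lambda>r. H s r))" if H: "jcont H" for H
  proof -
    have "(\<integral>r. indicator S (s, r) *\<^sub>R H s r \<partial>lborel)
        = indicator {0..x} s *\<^sub>R integral {0..x - s} (\<lambda>r. H s r)" for s
    proof (cases "s \<in> {0..x}")
      case True
      then have "indicator S (s, r) = (indicator {0..x - s} r :: real)" for r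
        by (auto simp: S_def indicator_def)
      then show ?thesis using True leb[of 0 "x - s" "H s"]
        by (simp add: jcont_compose[OF H])
    next
      case False
      then have "indicator S (s, r) = (0 :: real)" for r
        by (auto simp: S_def indicator_def)
      then show ?thesis using False by simp
    qed
    then show ?thesis using leb[OF param[OF H]] by simp
  qed
  have G': "jcont (\<lambda>r s. G s r)"
    using jcont_compose[OF G, of UNIV snd fst] by (simp add: case_prod_unfold continuous_intros)
  have "f s r = indicator S (r, s) *\<^sub>R G s r" for s r
    by (auto simp: S_def f_def indicator_def)
  then have "(\<integral>r. (\<integral>s. f s r \<partial>lborel) \<partial>lborel)
      = integral {0..x} (\<lambda>r. integral {0..x - r} (\<lambda>s. G s r))"
    using iter[OF G'] by simp
  moreover have "(\<integral>s. (\<integral>r. f s r \<partial>lborel) \<partial>lborel)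
      = integral {0..x} (\<lambda>s. integral {0..x - s} (\<lambda>r. G s r))"
    using iter[OF G] by (simp add: f_def)
  ultimately show ?thesis using swap by simp
qed

text \<open>For x >= 0 and smooth F this is the solution R of R_x - c R_y = F with R = 0 at x = 0,
  found by integrating back along the characteristic. The case c = 0 is integration in x; for x < 0
  the interval is empty and the value is 0.\<close>

definition ray_int :: "real \<Rightarrow> (real \<Rightarrow> real \<Rightarrow> real) \<Rightarrow> real \<Rightarrow> real \<Rightarrow> real" where
  "ray_int c F x y = integral {0..x} (\<lambda>s. F (x - s) (y + c * s))"

lemma ray_integrable:
  assumes "jcont F"
  shows "(\<lambda>s. F (x - s) (y + c * s)) integrable_on {a..b}"
  by (intro integrable_continuous_real jcont_compose[OF assms] continuous_intros)

lemma jcont_ray_int: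
  assumes F: "jcont F"
  shows "jcont (ray_int c F)"
proof -
  \<comment> \<open>After rescaling to [0, 1], \<open>max 0 x\<close> covers the empty interval for
    negative x, so one formula is jointly continuous on the whole plane.\<close>
  have eq: "ray_int c F x y = max 0 x * integral {0..1}
      (\<lambda>q. F (max 0 x - max 0 x * q) (y + c * (max 0 x * q)))" for x y
  proof (cases "x \<ge> 0")
    case True
    have "((\<lambda>q. x *\<^sub>R F (x - x * q) (y + c * (x * q))) has_integral
        (integral {x * 0..x * 1} (\<lambda>s. F (x - s) (y + c * s)))) {0..1}"
      by (rule has_integral_substitution[where c = 0 and d = x])
        (use True in \<open>auto intro!: derivative_eq_intros jcont_compose[OF F] continuous_intros
           simp: mult_left_le\<close>)
    then have "integral {0..1} (\<lambda>q. x * F (x - x * q) (y + c * (x * q))) = ray_int c F x y"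
      by (auto simp: has_integral_iff ray_int_def)
    then show ?thesis using True by simp
  qed (simp add: ray_int_def)
  have "continuous_on UNIV (\<lambda>p. integral (cbox 0 1)
      (\<lambda>q. F (max 0 (fst p) - max 0 (fst p) * q) (snd p + c * (max 0 (fst p) * q))))"
    by (rule integral_continuous_on_param)
      (auto simp: case_prod_unfold intro!: jcont_compose[OF F] continuous_intros)
  then show ?thesis
    unfolding eq case_prod_unfold by (auto intro!: continuous_intros)
qed

text \<open>Inverses of constant-coefficient operators commute: both sides integrate the same
  function of s and r over the triangle, in the two orders.\<close>

lemma ray_int_commute:
  assumes F: "jcont F"
  shows "ray_int c (ray_int d F) x y = ray_int d (ray_int c F) x y"
proof -
  define G where "G s r = F (x - s - r) (y + c * s + d * r)" for s r
  have G: "jcont G"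
    unfolding G_def case_prod_unfold by (intro jcont_compose[OF F] continuous_intros)
  have "ray_int d (ray_int c F) x y = integral {0..x} (\<lambda>r. integral {0..x - r} (\<lambda>s. G s r))"
    unfolding ray_int_def G_def by (simp add: algebra_simps)
  also have "\<dots> = ray_int c (ray_int d F) x y"
    using integral_triangle_swap[OF G, of x] unfolding ray_int_def G_def by simp
  finally show ?thesis by simp
qed

section \<open>The integral form of the wave equation\<close>

text \<open>Against the weight exp (k x) each integration from 0 gains a factor 1 / k; a suitable k
  later makes the Volterra term a contraction.\<close>

lemma ray_int_bound:
  assumes F: "jcont F" and "0 \<le> x" "k > 0" "m \<ge> 0"
    and le: "\<And>s. 0 \<le> s \<Longrightarrow> s \<le> x \<Longrightarrow> \<bar>F (x - s) (y + c * s)\<bar> \<le> m * exp (k * (x - s))"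
  shows "\<bar>ray_int c F x y\<bar> \<le> m / k * exp (k * x)"
proof -
  have "((\<lambda>s. m * exp (k * (x - s))) has_integral
      (- m / k * exp (k * (x - x)) - (- m / k * exp (k * (x - 0))))) {0..x}"
    by (rule fundamental_theorem_of_calculus)
      (use assms in \<open>auto simp flip: has_real_derivative_iff_has_vector_derivative
         intro!: derivative_eq_intros\<close>)
  then have I: "((\<lambda>s. m * exp (k * (x - s))) has_integral (m / k * exp (k * x) - m / k)) {0..x}"
    by simp
  have "norm (ray_int c F x y) \<le> integral {0..x} (\<lambda>s. m * exp (k * (x - s)))"
    unfolding ray_int_def
    by (rule integral_norm_bound_integral)
      (use le I in \<open>auto intro!: ray_integrable[OF F] simp: has_integral_iff\<close>)
  also have "\<dots> \<le> m / k * exp (k * x)"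
    using I assms by (simp add: has_integral_iff)
  finally show ?thesis by simp
qed

lemma ray_int_lin:
  assumes "jcont F" "jcont G"
  shows "ray_int c (\<lambda>s z. a * F s z + b * G s z) = (\<lambda>x y. a * ray_int c F x y + b * ray_int c G x y)"
proof (intro ext)
  fix x y
  show "ray_int c (\<lambda>s z. a * F s z + b * G s z) x y = a * ray_int c F x y + b * ray_int c G x y"
    unfolding ray_int_def
    by (subst integral_add) (simp_all add: ray_integrable assms integrable_on_mult_right)
qed

text \<open>Needed for c = 0, where the ray keeps y fixed and multiplication by a function of y
  commutes with integration in x.\<close>

lemma ray_int_mult_left:
  assumes "jcont F" "\<And>s. 0 \<le> s \<Longrightarrow> s \<le> x \<Longrightarrow> p (y + c * s) = p y"
  shows "ray_int c (\<lambda>s z. p z * F s z) x y = p y * ray_int c F x y"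
proof -
  have "ray_int c (\<lambda>s z. p z * F s z) x y = integral {0..x} (\<lambda>s. p y * F (x - s) (y + c * s))"
    unfolding ray_int_def by (rule integral_cong) (use assms in auto)
  then show ?thesis by (simp add: ray_int_def)
qed

text \<open>The inverse of \<open>\<partial>\<^sub>x\<^sup>2 - \<partial>\<^sub>y\<^sup>2\<close> with zero data at \<open>x = 0\<close>. Factoring it into integrals along the two
  characteristics makes it commute with integration in \<open>x\<close>, by \<open>ray_int_commute\<close>.\<close>

definition duhamel :: "(real \<Rightarrow> real \<Rightarrow> real) \<Rightarrow> real \<Rightarrow> real \<Rightarrow> real" where
  "duhamel F = ray_int 1 (ray_int (- 1) F)"

lemma jcont_duhamel: "jcont F \<Longrightarrow> jcont (duhamel F)"
  unfolding duhamel_def by (intro jcont_ray_int)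

lemma duhamel_lin:
  assumes "jcont F" "jcont G"
  shows "duhamel (\<lambda>s z. a * F s z + b * G s z) = (\<lambda>x y. a * duhamel F x y + b * duhamel G x y)"
  unfolding duhamel_def using assms by (simp add: ray_int_lin jcont_ray_int)

text \<open>Finite speed of propagation: the integration only visits the backward triangle below (x,
  y).\<close>

lemma duhamel_cong:
  assumes "0 \<le> x" "\<And>s z. 0 \<le> s \<Longrightarrow> s \<le> x \<Longrightarrow> \<bar>z - y\<bar> \<le> x - s \<Longrightarrow> F s z = G s z"
  shows "duhamel F x y = duhamel G x y"
  unfolding duhamel_def ray_int_def by (intro integral_cong assms(2)) (use assms(1) in auto)

lemma duhamel_bound:
  assumes F: "jcont F" and "0 \<le> x" "k > 0" "m \<ge> 0"
    and le: "\<And>s z. 0 \<le> s \<Longrightarrow> s \<le> x \<Longrightarrow> \<bar>z - y\<bar> \<le> x - s \<Longrightarrow> \<bar>F s z\<bar> \<le> m * exp (k * s)"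
  shows "\<bar>duhamel F x y\<bar> \<le> m / k\<^sup>2 * exp (k * x)"
proof -
  have "\<bar>duhamel F x y\<bar> \<le> m / k / k * exp (k * x)"
    unfolding duhamel_def
  proof (rule ray_int_bound)
    fix s assume s: "0 \<le> s" "s \<le> x"
    show "\<bar>ray_int (- 1) F (x - s) (y + 1 * s)\<bar> \<le> m / k * exp (k * (x - s))"
      by (rule ray_int_bound) (use s assms in auto)
  qed (use assms in \<open>auto intro: jcont_ray_int\<close>)
  then show ?thesis by (simp add: power2_eq_square)
qed

lemma jcont_mult_snd:
  assumes "continuous_on UNIV p" "jcont F"
  shows "jcont (\<lambda>s z. p z * F s z)"
proof -
  have "continuous_on UNIV (\<lambda>q. p (snd q) * F (fst q) (snd q))"
    by (intro continuous_intros jcont_compose[OF assms(2)] continuous_on_compose2[OF assms(1)]) auto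
  then show ?thesis by (simp add: case_prod_unfold)
qed

section \<open>Volterra estimates and solvability of the integral equation\<close>

lemma half_bound: "(M::real) \<ge> 0 \<Longrightarrow> M / (M + 1)\<^sup>2 \<le> 1 / 2"
  by (simp add: divide_simps power2_eq_square algebra_simps)

text \<open>At the point of the compact triangle where \<open>\<bar>W\<bar> * exp (- k * s)\<close>
  is largest, the Duhamel term is at most half of \<open>\<bar>W\<bar>\<close>, because backward
  triangles stay inside the large one. Absorbing it produces the factor 2.\<close>

lemma triangle_gronwall:
  assumes W: "jcont W" and P: "continuous_on UNIV P"
    and M: "M \<ge> 0" "\<And>z. \<bar>z\<bar> \<le> X \<Longrightarrow> \<bar>P z\<bar> \<le> M"
    and A: "\<And>s z. 0 \<le> s \<Longrightarrow> s + \<bar>z\<bar> \<le> X \<Longrightarrow> \<bar>W s z + duhamel (\<lambda>s z. P z * W s z) s z\<bar> \<le> A"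
    and sz: "0 \<le> s" "s + \<bar>z\<bar> \<le> X"
  shows "\<bar>W s z\<bar> \<le> 2 * A * exp ((M + 1) * s)"
proof -
  \<comment> \<open>With this weight \<open>half_bound\<close> turns the factor M / k^2 of
    \<open>duhamel_bound\<close> into at most 1/2.\<close>
  define k where "k = M + 1"
  have k: "k > 0" using M by (simp add: k_def)
  define S where "S = {p. 0 \<le> fst p \<and> fst p + \<bar>snd p\<bar> \<le> X}"
  have "closed S"
    unfolding S_def by (intro closed_Collect_conj closed_Collect_le continuous_intros)
  moreover have "S \<subseteq> {0..X} \<times> {-X..X}" unfolding S_def by auto
  then have "bounded S"
    by (rule bounded_subset[rotated]) (intro bounded_Times bounded_closed_interval)
  ultimately have cS: "compact S" by (simp add: compact_eq_bounded_closed)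
  have ne: "(s, z) \<in> S" using sz by (simp add: S_def)
  have "continuous_on S (\<lambda>p. \<bar>W (fst p) (snd p)\<bar> * exp (- k * fst p))"
    by (intro continuous_intros jcont_compose[OF W])
  from continuous_attains_sup[OF cS _ this] ne obtain p where p: "p \<in> S"
    and max: "\<And>q. q \<in> S \<Longrightarrow> \<bar>W (fst q) (snd q)\<bar> * exp (- k * fst q)
      \<le> \<bar>W (fst p) (snd p)\<bar> * exp (- k * fst p)" by blast
  define m where "m = \<bar>W (fst p) (snd p)\<bar> * exp (- k * fst p)"
  have m: "m \<ge> 0" by (simp add: m_def)
  have le: "\<bar>W r y\<bar> \<le> m * exp (k * r)" if "0 \<le> r" "r + \<bar>y\<bar> \<le> X" for r y
  proof -
    have "\<bar>W r y\<bar> * exp (- k * r) \<le> m" using max[of "(r, y)"] that by (simp add: S_def m_def)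
    then have "\<bar>W r y\<bar> * exp (- k * r) * exp (k * r) \<le> m * exp (k * r)"
      by (intro mult_right_mono) auto
    then show ?thesis by (simp add: mult.assoc flip: exp_add)
  qed
  obtain x y where xy: "p = (x, y)" by (cases p)
  have x: "0 \<le> x" "x + \<bar>y\<bar> \<le> X" using p by (auto simp: S_def xy)
  have "\<bar>duhamel (\<lambda>s z. P z * W s z) x y\<bar> \<le> M * m / k\<^sup>2 * exp (k * x)"
  proof (rule duhamel_bound)
    fix r q assume r: "0 \<le> r" "r \<le> x" "\<bar>q - y\<bar> \<le> x - r"
    then have "\<bar>P q\<bar> \<le> M" "\<bar>W r q\<bar> \<le> m * exp (k * r)"
      using x by (auto intro!: M le)
    then have "\<bar>P q\<bar> * \<bar>W r q\<bar> \<le> M * (m * exp (k * r))"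
      by (intro mult_mono) (use M in auto)
    then show "\<bar>P q * W r q\<bar> \<le> M * m * exp (k * r)" by (simp add: abs_mult mult.assoc)
  qed (use x k M m in \<open>auto intro: jcont_mult_snd[OF P W]\<close>)
  also have "M * m / k\<^sup>2 * exp (k * x) = M / k\<^sup>2 * (m * exp (k * x))" by simp
  also have "\<dots> \<le> 1 / 2 * (m * exp (k * x))"
    by (rule mult_right_mono) (use half_bound[OF M(1)] m in \<open>auto simp: k_def\<close>)
  \<comment> \<open>Equality holds because (x, y) is the maximum point; the estimate then reads
    \<open>\<bar>W x y\<bar> \<le> A + \<bar>W x y\<bar> / 2\<close>.\<close>
  also have "m * exp (k * x) = \<bar>W x y\<bar>" by (simp add: m_def xy mult.assoc flip: exp_add)
  finally have "\<bar>W x y\<bar> \<le> 2 * A" using A[OF x] by linarith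
  moreover have A0: "0 \<le> A" using A[OF x] by linarith
  have "m \<le> \<bar>W x y\<bar> * 1"
    unfolding m_def xy fst_conv snd_conv by (rule mult_left_mono) (use x k in auto)
  ultimately have "m \<le> 2 * A" by simp
  then have "m * exp (k * s) \<le> 2 * A * exp (k * s)" by (intro mult_right_mono) auto
  with le[OF sz] show ?thesis unfolding k_def by linarith
qed

text \<open>Banach's fixed point theorem for b = exp (- k x) W among bounded continuous functions:
  the weight gives the contraction constant 1/2 and also admits growth of W. Since these functions
  live on the whole plane, x is frozen at 0 for negative x.\<close>

lemma wave_exists:
  assumes H: "jcont H" and B: "\<And>x y. 0 \<le> x \<Longrightarrow> \<bar>H x y\<bar> \<le> B"
    and P: "continuous_on UNIV P" and M: "\<And>z. \<bar>P z\<bar> \<le> M"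
  shows "\<exists>W. jcont W \<and> (\<forall>x\<ge>0. \<forall>y. W x y = H x y - duhamel (\<lambda>s z. P z * W s z) x y)"
proof -
  define k where "k = M + 1"
  have M0: "M \<ge> 0" using M[of 0] by linarith
  have k: "k > 0" using M0 by (simp add: k_def)
  define E :: "((real \<times> real) \<Rightarrow>\<^sub>C real) \<Rightarrow> real \<Rightarrow> real \<Rightarrow> real"
    where "E b s z = exp (k * max 0 s) * apply_bcontfun b (s, z)" for b s z
  have E: "jcont (E b)" for b
    unfolding E_def case_prod_unfold
    by (intro continuous_intros) auto
  have PE: "jcont (\<lambda>s z. P z * E b s z)" for b by (rule jcont_mult_snd[OF P E])
  define N where "N b x y = H x y - duhamel (\<lambda>s z. P z * E b s z) x y" for b x y
  have "continuous_on UNIV (\<lambda>p. N b (fst p) (snd p))" for b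
    unfolding N_def by (intro continuous_intros jcont_compose[OF H] jcont_compose[OF jcont_duhamel[OF PE]])
  then have jN: "jcont (N b)" for b by (simp add: case_prod_unfold)
  define R where "R b p = exp (- k * max 0 (fst p)) * N b (max 0 (fst p)) (snd p)" for b p
  have D: "\<bar>duhamel (\<lambda>s z. P z * F s z) x y\<bar> \<le> d / 2 * exp (k * x)"
    if F: "jcont F" and "0 \<le> x" "\<And>s z. 0 \<le> s \<Longrightarrow> \<bar>F s z\<bar> \<le> d * exp (k * s)" "d \<ge> 0"
    for F :: "real \<Rightarrow> real \<Rightarrow> real" and x y d
  proof -
    have "\<bar>duhamel (\<lambda>s z. P z * F s z) x y\<bar> \<le> M * d / k\<^sup>2 * exp (k * x)"
    proof (rule duhamel_bound)
      fix s z :: real assume "0 \<le> s"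
      then have "\<bar>P z\<bar> * \<bar>F s z\<bar> \<le> M * (d * exp (k * s))"
        by (intro mult_mono M that(3)) (use M0 in auto)
      then show "\<bar>P z * F s z\<bar> \<le> M * d * exp (k * s)" by (simp add: abs_mult mult.assoc)
    qed (use that k M0 in \<open>auto intro: jcont_mult_snd[OF P F]\<close>)
    also have "\<dots> = M / k\<^sup>2 * (d * exp (k * x))" by simp
    also have "\<dots> \<le> 1 / 2 * (d * exp (k * x))"
      by (rule mult_right_mono) (use half_bound[OF M0] that in \<open>auto simp: k_def\<close>)
    finally show ?thesis by simp
  qed
  have R: "R b \<in> bcontfun" for b
  proof -
    have "continuous_on UNIV (R b)"
      unfolding R_def by (intro continuous_intros jcont_compose[OF jN])
    moreover obtain d where d: "\<And>p. \<bar>apply_bcontfun b p\<bar> \<le> d"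
      using bounded_apply_bcontfun[of b] by (auto simp: bounded_iff)
    have d0: "d \<ge> 0" using d[of 0] by linarith
    have "\<bar>R b p\<bar> \<le> B + d / 2" for p
    proof -
      define x where "x = max 0 (fst p)"
      have x: "x \<ge> 0" by (simp add: x_def)
      have "\<bar>duhamel (\<lambda>s z. P z * E b s z) x (snd p)\<bar> \<le> d / 2 * exp (k * x)"
        by (rule D[OF E x]) (use d d0 in \<open>simp_all add: E_def abs_mult max_def mult.commute\<close>)
      moreover have "\<bar>H x (snd p)\<bar> \<le> B * exp (k * x)"
        using B[OF x, of "snd p"] x k
        by (smt (verit) mult_left_le_one_le mult_le_cancel_left1 one_le_exp_iff mult_nonneg_nonneg)
      ultimately have "\<bar>N b x (snd p)\<bar> \<le> (B + d / 2) * exp (k * x)"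
        unfolding N_def ring_distribs by linarith
      then have "exp (- k * x) * \<bar>N b x (snd p)\<bar> \<le> exp (- k * x) * ((B + d / 2) * exp (k * x))"
        by (intro mult_left_mono) auto
      also have "\<dots> = B + d / 2" by (simp add: exp_minus)
      finally show ?thesis by (simp add: R_def x_def abs_mult)
    qed
    then have "bounded (range (R b))" by (auto simp: bounded_iff)
    ultimately show ?thesis by (simp add: bcontfun_def)
  qed
  define G where "G b = Bcontfun (R b)" for b
  have G: "apply_bcontfun (G b) = R b" for b
    unfolding G_def by (rule Bcontfun_inverse[OF R])
  have "dist (G b) (G b') \<le> 1 / 2 * dist b b'" for b b'
  proof (rule dist_bound)
    fix p :: "real \<times> real"
    define x where "x = max 0 (fst p)"
    have x: "x \<ge> 0" by (simp add: x_def)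
    define F where "F s z = 1 * E b' s z + (- 1) * E b s z" for s z
    have F: "jcont F"
      unfolding F_def case_prod_unfold by (intro continuous_intros jcont_compose[OF E])
    have "N b x (snd p) - N b' x (snd p)
        = 1 * duhamel (\<lambda>s z. P z * E b' s z) x (snd p) + (- 1) * duhamel (\<lambda>s z. P z * E b s z) x (snd p)"
      by (simp add: N_def)
    also have "\<dots> = duhamel (\<lambda>s z. 1 * (P z * E b' s z) + (- 1) * (P z * E b s z)) x (snd p)"
      by (subst duhamel_lin[OF PE PE]) simp
    also have "\<dots> = duhamel (\<lambda>s z. P z * F s z) x (snd p)"
      by (simp add: F_def algebra_simps)
    finally have eq: "N b x (snd p) - N b' x (snd p) = duhamel (\<lambda>s z. P z * F s z) x (snd p)" .
    have "\<bar>duhamel (\<lambda>s z. P z * F s z) x (snd p)\<bar> \<le> dist b b' / 2 * exp (k * x)"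
    proof (rule D[OF F])
      fix s z :: real assume s: "0 \<le> s"
      have "\<bar>F s z\<bar> = exp (k * s) * dist (apply_bcontfun b (s, z)) (apply_bcontfun b' (s, z))"
        using s by (simp add: F_def E_def dist_real_def abs_mult abs_minus_commute flip: right_diff_distrib)
      also have "\<dots> \<le> exp (k * s) * dist b b'" by (intro mult_left_mono dist_bounded) auto
      finally show "\<bar>F s z\<bar> \<le> dist b b' * exp (k * s)" by (simp add: mult.commute)
    qed (use x in auto)
    then have "exp (- k * x) * \<bar>N b x (snd p) - N b' x (snd p)\<bar>
        \<le> exp (- k * x) * (dist b b' / 2 * exp (k * x))"
      unfolding eq by (intro mult_left_mono) auto
    also have "\<dots> = 1 / 2 * dist b b'" by (simp add: exp_minus)
    finally show "dist (apply_bcontfun (G b) p) (apply_bcontfun (G b') p) \<le> 1 / 2 * dist b b'"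
      by (simp add: G R_def x_def dist_real_def abs_mult flip: right_diff_distrib)
  qed
  then have "\<exists>!b. G b = b" by (intro banach_fix_type[of "1 / 2"]) auto
  then obtain b where b: "G b = b" by blast
  have "E b x y = H x y - duhamel (\<lambda>s z. P z * E b s z) x y" if "x \<ge> 0" for x y
  proof -
    have "apply_bcontfun b (x, y) = exp (- k * x) * N b x y"
      using G[of b] that by (simp add: b R_def)
    then show ?thesis using that by (simp add: E_def N_def flip: exp_add mult.assoc)
  qed
  with E[of b] show ?thesis by blast
qed

section \<open>Antiderivatives and d'Alembert's formula\<close>

lemma antiderivative_exists:
  fixes h :: "real \<Rightarrow> real"
  assumes "continuous_on UNIV h"
  shows "\<exists>H. H 0 = c \<and> (\<forall>y. (H has_real_derivative h y) (at y))"
proof -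
  have "\<exists>H. \<forall>x. -\<infinity> < ereal x \<longrightarrow> ereal x < \<infinity> \<longrightarrow> (H has_vector_derivative h x) (at x)"
    by (rule einterval_antiderivative) (use assms in \<open>auto simp: continuous_on_eq_continuous_at\<close>)
  then obtain H where H: "\<And>x. (H has_real_derivative h x) (at x)"
    by (auto simp: has_real_derivative_iff_has_vector_derivative)
  show ?thesis
    by (rule exI[of _ "\<lambda>y. H y - H 0 + c"]) (auto intro!: derivative_eq_intros H)
qed

lemma ray_int_FTC:
  assumes "0 \<le> x"
    and "\<And>s. 0 \<le> s \<Longrightarrow> s \<le> x \<Longrightarrow> (K has_real_derivative F (x - s) (y + c * s)) (at s within {0..x})"
  shows "ray_int c F x y = K x - K 0"
proof -
  have "((\<lambda>s. F (x - s) (y + c * s)) has_integral (K x - K 0)) {0..x}"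
    by (rule fundamental_theorem_of_calculus)
      (use assms in \<open>auto simp flip: has_real_derivative_iff_has_vector_derivative\<close>)
  then show ?thesis by (simp add: ray_int_def has_integral_iff)
qed

lemma ray_int_cong:
  assumes "\<And>s. 0 \<le> s \<Longrightarrow> s \<le> x \<Longrightarrow> F (x - s) (y + c * s) = G (x - s) (y + c * s)"
  shows "ray_int c F x y = ray_int c G x y"
  unfolding ray_int_def by (rule integral_cong) (use assms in auto)

lemma ray_int_0_FTC:
  assumes "0 \<le> x" "\<And>r. 0 \<le> r \<Longrightarrow> (K has_real_derivative F r y) (at r)"
  shows "ray_int 0 F x y = K x - K 0"
proof -
  have "ray_int 0 F x y = - K (x - x) - - K (x - 0)"
  proof (rule ray_int_FTC)
    fix s assume "0 \<le> s" "s \<le> x"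
    then have "((\<lambda>s. K (x - s)) has_real_derivative F (x - s) y * - 1) (at s)"
      by (intro DERIV_chain2[OF assms(2)]) (auto intro!: derivative_eq_intros)
    from DERIV_minus[OF this] have "((\<lambda>s. - K (x - s)) has_real_derivative F (x - s) y) (at s)"
      by simp
    then show "((\<lambda>s. - K (x - s)) has_real_derivative F (x - s) (y + 0 * s)) (at s within {0..x})"
      by (simp add: has_field_derivative_at_within)
  qed fact
  then show ?thesis by simp
qed

lemma ray_int_0_has_derivative:
  assumes F: "jcont F" and x: "x \<in> {0..L}"
  shows "((\<lambda>x. ray_int 0 F x y) has_real_derivative F x y) (at x within {0..L})"
proof -
  have "continuous_on UNIV (\<lambda>s. F s y)" by (intro jcont_compose[OF F] continuous_intros)
  from antiderivative_exists[OF this] obtain K where K: "\<And>s. (K has_real_derivative F s y) (at s)"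
    by metis
  have eq: "ray_int 0 F x y = K x - K 0" if "0 \<le> x" for x
    by (rule ray_int_0_FTC) (use that K in auto)
  have K': "((\<lambda>x. K x - K 0) has_real_derivative F x y) (at x within {0..L})"
    using DERIV_diff[OF has_field_derivative_at_within[OF K] DERIV_const] by simp
  show ?thesis
    by (rule has_field_derivative_transform_within[OF K', of 1]) (use x eq in auto)
qed

text \<open>d'Alembert's solution of the free wave equation with initial value f and initial
  velocity 0.\<close>

definition wave_mean :: "(real \<Rightarrow> real) \<Rightarrow> real \<Rightarrow> real \<Rightarrow> real" where
  "wave_mean f x y = (f (y + x) + f (y - x)) / 2"

lemma jcont_wave_mean:
  assumes "continuous_on UNIV f"
  shows "jcont (wave_mean f)"
  unfolding wave_mean_def case_prod_unfold
  by (intro continuous_intros continuous_on_compose2[OF assms]) auto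

text \<open>For F'' = h the second x-derivative of \<open>wave_mean F\<close> is
  \<open>wave_mean h\<close>; at x = 0 its value is F y and its first x-derivative vanishes.\<close>

lemma dAlembert:
  assumes h: "\<And>y. (F1 has_real_derivative h y) (at y)"
    and F1: "\<And>y. (F has_real_derivative F1 y) (at y)" and x: "0 \<le> x"
  shows "ray_int 0 (ray_int 0 (wave_mean h)) x y = wave_mean F x y - F y"
proof -
  have h2: "((\<lambda>x. F1 (g x)) has_real_derivative h (g x) * g') (at x)"
    if "(g has_real_derivative g') (at x)" for g g' x
    by (rule DERIV_chain2[OF h that])
  have F2: "((\<lambda>x. F (g x)) has_real_derivative F1 (g x) * g') (at x)"
    if "(g has_real_derivative g') (at x)" for g g' x
    by (rule DERIV_chain2[OF F1 that])
  define D where "D x y = (F1 (y + x) - F1 (y - x)) / 2" for x y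
  have "ray_int 0 (wave_mean h) x y = D x y - D 0 y" if "0 \<le> x" for x y
    by (rule ray_int_0_FTC[OF that])
      (auto simp: wave_mean_def D_def intro!: derivative_eq_intros h2)
  then have "ray_int 0 (ray_int 0 (wave_mean h)) x y = ray_int 0 D x y"
    using x by (intro ray_int_cong) (auto simp: D_def)
  also have "\<dots> = wave_mean F x y - wave_mean F 0 y"
    by (rule ray_int_0_FTC[OF x])
      (auto simp: wave_mean_def D_def intro!: derivative_eq_intros F2)
  finally show ?thesis by (simp add: wave_mean_def)
qed

text \<open>If G2'' = g, both sides equal \<open>wave_mean G2 x y - G2 y\<close>, which has zero
  Cauchy data at x = 0 and is sent to g by
  \<open>\<partial>\<^sub>x\<^sup>2 - \<partial>\<^sub>y\<^sup>2\<close>. This trades a Duhamel term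
  for integrations in x.\<close>

lemma duhamel_stationary:
  assumes g: "continuous_on UNIV g" and x: "0 \<le> x"
  shows "duhamel (\<lambda>s z. g z) x y = ray_int 0 (ray_int 0 (wave_mean g)) x y"
proof -
  obtain G where G: "\<And>y. (G has_real_derivative g y) (at y)"
    using antiderivative_exists[OF g] by auto
  have "continuous_on UNIV G"
    by (rule DERIV_continuous_on) (use G has_field_derivative_at_within in blast)
  from antiderivative_exists[OF this]
  obtain G2 where G2: "\<And>y. (G2 has_real_derivative G y) (at y)" by auto
  have G': "((\<lambda>x. G (k x)) has_real_derivative g (k x) * k') (at x within S)"
    if "(k has_real_derivative k') (at x within S)" for k k' x S
    by (rule DERIV_chain2[OF G that])
  have G2': "((\<lambda>x. G2 (k x)) has_real_derivative G (k x) * k') (at x within S)"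
    if "(k has_real_derivative k') (at x within S)" for k k' x S
    by (rule DERIV_chain2[OF G2 that])
  have inner: "ray_int (- 1) (\<lambda>s z. g z) x y = G y - G (y - x)" if "0 \<le> x" for x y
    by (subst ray_int_FTC[where K = "\<lambda>s. - G (y - s)", OF that])
      (auto intro!: derivative_eq_intros G')
  have "duhamel (\<lambda>s z. g z) x y = ray_int 1 (\<lambda>x y. G y - G (y - x)) x y"
    unfolding duhamel_def by (intro ray_int_cong inner) auto
  also have "\<dots> = (\<lambda>s. G2 (y + s) - G2 (y - x + 2 * s) / 2) x
      - (\<lambda>s. G2 (y + s) - G2 (y - x + 2 * s) / 2) 0"
    by (rule ray_int_FTC[OF x])
      (auto intro!: derivative_eq_intros G2' simp: algebra_simps)
  also have "\<dots> = wave_mean G2 x y - G2 y"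
    by (simp add: wave_mean_def field_simps)
  finally show ?thesis using dAlembert[OF G G2 x] by simp
qed

section \<open>The wave equation with data on [0, L]\<close>

definition even_ext :: "real \<Rightarrow> (real \<Rightarrow> real) \<Rightarrow> real \<Rightarrow> real" where
  "even_ext L f y = f (min L \<bar>y\<bar>)"

text \<open>Clamping keeps every argument in [0, L], so continuity and sup bounds carry over to the
  whole line, where the fixed point argument takes place.\<close>

lemma even_ext_range: "(L :: real) > 0 \<Longrightarrow> min L \<bar>y\<bar> \<in> {0..L}"
  by auto

lemma continuous_even_ext:
  assumes "L > 0" "continuous_on {0..L} f"
  shows "continuous_on UNIV (even_ext L f)"
  unfolding even_ext_def
  by (rule continuous_on_compose2[OF assms(2)]) (use assms(1) in \<open>auto intro!: continuous_intros\<close>)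

lemma continuous_Icc_bounded:
  fixes f :: "real \<Rightarrow> real"
  assumes "continuous_on {a..b} f"
  obtains B where "B \<ge> 0" "\<And>x. x \<in> {a..b} \<Longrightarrow> \<bar>f x\<bar> \<le> B"
proof -
  have "bounded (f ` {a..b})"
    by (intro compact_imp_bounded compact_continuous_image assms compact_Icc)
  then obtain B where "B > 0" "\<forall>x\<in>{a..b}. \<bar>f x\<bar> \<le> B"
    by (auto simp: bounded_pos)
  then show thesis using that[of B] by auto
qed

text \<open>Duhamel's form of \<open>W\<^sub>x\<^sub>x = W\<^sub>y\<^sub>y - P W\<close>, \<open>W (0, y) = f (y)\<close>, \<open>W\<^sub>x (0, y) = 0\<close>. The extensions are clamped at \<open>L\<close>, so
  the wave equation is only meaningful in the triangle \<open>x + \<bar>y\<bar> \<le> L\<close>.\<close>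

definition wave_sol :: "real \<Rightarrow> (real \<Rightarrow> real) \<Rightarrow> (real \<Rightarrow> real) \<Rightarrow> real \<Rightarrow> real \<Rightarrow> real" where
  "wave_sol L P f = (SOME W. jcont W \<and> (\<forall>x\<ge>0. \<forall>y. W x y
     = wave_mean (even_ext L f) x y - duhamel (\<lambda>s z. even_ext L P z * W s z) x y))"

lemma
  assumes L: "L > 0" and P: "continuous_on {0..L} P" and f: "continuous_on {0..L} f"
  shows jcont_wave_sol: "jcont (wave_sol L P f)"
    and wave_sol_eq: "0 \<le> x \<Longrightarrow> wave_sol L P f x y
      = wave_mean (even_ext L f) x y - duhamel (\<lambda>s z. even_ext L P z * wave_sol L P f s z) x y"
proof -
  obtain M where M: "\<And>x. x \<in> {0..L} \<Longrightarrow> \<bar>P x\<bar> \<le> M" using continuous_Icc_bounded[OF P] by metis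
  obtain B where B: "\<And>x. x \<in> {0..L} \<Longrightarrow> \<bar>f x\<bar> \<le> B" using continuous_Icc_bounded[OF f] by metis
  have fe: "\<bar>even_ext L f y\<bar> \<le> B" for y unfolding even_ext_def by (intro B even_ext_range L)
  have "\<exists>W. jcont W \<and> (\<forall>x\<ge>0. \<forall>y. W x y
     = wave_mean (even_ext L f) x y - duhamel (\<lambda>s z. even_ext L P z * W s z) x y)"
  proof (rule wave_exists)
    show "\<bar>wave_mean (even_ext L f) x y\<bar> \<le> B" for x y
      unfolding wave_mean_def using fe[of "y + x"] fe[of "y - x"] by (simp add: abs_le_iff)
    show "\<bar>even_ext L P z\<bar> \<le> M" for z unfolding even_ext_def by (intro M even_ext_range L)
  qed (intro jcont_wave_mean continuous_even_ext L f P)+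
  from someI_ex[OF this] show "jcont (wave_sol L P f)"
    and "0 \<le> x \<Longrightarrow> wave_sol L P f x y
      = wave_mean (even_ext L f) x y - duhamel (\<lambda>s z. even_ext L P z * wave_sol L P f s z) x y"
    by (simp_all add: wave_sol_def)
qed

text \<open>The clamped potential is bounded by M on the whole line, so triangles of any size X are
  allowed.\<close>

lemma wave_sol_gronwall:
  assumes L: "L > 0" and P: "continuous_on {0..L} P" and W: "jcont W"
    and M: "\<And>x. x \<in> {0..L} \<Longrightarrow> \<bar>P x\<bar> \<le> M"
    and A: "\<And>s z. 0 \<le> s \<Longrightarrow> s + \<bar>z\<bar> \<le> X \<Longrightarrow> \<bar>W s z + duhamel (\<lambda>s z. even_ext L P z * W s z) s z\<bar> \<le> A"
    and sz: "0 \<le> s" "s + \<bar>z\<bar> \<le> X"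
  shows "\<bar>W s z\<bar> \<le> 2 * A * exp ((M + 1) * s)"
proof (rule triangle_gronwall[OF W continuous_even_ext[OF L P] _ _ A sz])
  show "0 \<le> M" using M[of 0] L by auto
  show "\<bar>even_ext L P z\<bar> \<le> M" for z unfolding even_ext_def by (intro M even_ext_range L)
qed

lemma wave_sol_unique:
  assumes L: "L > 0" and P: "continuous_on {0..L} P" and W: "jcont W"
    and A: "\<And>s z. 0 \<le> s \<Longrightarrow> s + \<bar>z\<bar> \<le> X \<Longrightarrow> W s z + duhamel (\<lambda>s z. even_ext L P z * W s z) s z = 0"
    and sz: "0 \<le> s" "s + \<bar>z\<bar> \<le> X"
  shows "W s z = 0"
proof -
  obtain M where M: "\<And>x. x \<in> {0..L} \<Longrightarrow> \<bar>P x\<bar> \<le> M" using continuous_Icc_bounded[OF P] by metis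
  show ?thesis using wave_sol_gronwall[OF L P W M _ sz, of 0] A by auto
qed

lemma wave_sol_bound:
  assumes L: "L > 0" and P: "continuous_on {0..L} P" and f: "continuous_on {0..L} f"
    and M: "\<And>x. x \<in> {0..L} \<Longrightarrow> \<bar>P x\<bar> \<le> M" and B: "\<And>x. x \<in> {0..L} \<Longrightarrow> \<bar>f x\<bar> \<le> B"
    and s: "0 \<le> s"
  shows "\<bar>wave_sol L P f s z\<bar> \<le> 2 * B * exp ((M + 1) * s)"
proof (rule wave_sol_gronwall[OF L P jcont_wave_sol[OF L P f] M _ s order_refl])
  fix s z :: real assume s: "0 \<le> s"
  have fe: "\<bar>even_ext L f y\<bar> \<le> B" for y unfolding even_ext_def by (intro B even_ext_range L)
  show "\<bar>wave_sol L P f s z + duhamel (\<lambda>s z. even_ext L P z * wave_sol L P f s z) s z\<bar> \<le> B"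
    using wave_sol_eq[OF L P f s, of z] fe[of "z + s"] fe[of "z - s"] by (simp add: wave_mean_def)
qed

text \<open>The relation \<open>f'' - P f = g\<close> with \<open>f' (0) = 0\<close>.\<close>

definition neumann :: "real \<Rightarrow> (real \<Rightarrow> real) \<Rightarrow> (real \<Rightarrow> real) \<Rightarrow> (real \<Rightarrow> real) \<Rightarrow> bool" where
  "neumann L P f g \<longleftrightarrow> continuous_on {0..L} g \<and> (\<exists>f1. f1 0 = 0 \<and>
     (\<forall>x\<in>{0..L}. (f has_real_derivative f1 x) (at x within {0..L})
       \<and> (f1 has_real_derivative g x + P x * f x) (at x within {0..L})))"

lemma neumann_continuous: "neumann L P f g \<Longrightarrow> continuous_on {0..L} f"
  unfolding neumann_def by (auto intro: DERIV_continuous_on)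

lemma DERIV_eq_on_Icc:
  fixes f g :: "real \<Rightarrow> real"
  assumes "\<And>x. x \<in> {0..L} \<Longrightarrow> (f has_real_derivative f' x) (at x within {0..L})"
    and "\<And>x. x \<in> {0..L} \<Longrightarrow> (g has_real_derivative f' x) (at x within {0..L})"
    and "f 0 = g 0" "x \<in> {0..L}"
  shows "f x = g x"
proof -
  have "\<exists>c. \<forall>x\<in>{0..L}. f x - g x = c"
  proof (rule has_field_derivative_zero_constant)
    show "((\<lambda>x. f x - g x) has_real_derivative 0) (at x within {0..L})" if "x \<in> {0..L}" for x
      using DERIV_diff[OF assms(1,2)[OF that]] by simp
  qed auto
  then obtain c where c: "\<forall>x\<in>{0..L}. f x - g x = c" ..
  have "0 \<in> {0..L}" using assms(4) by auto
  with c assms(3) have "c = 0" by force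
  with c assms(4) show ?thesis by auto
qed

text \<open>The condition f'(0) = 0 makes the even extension twice differentiable across 0.
  Integrating the even function h twice avoids gluing there: F1 is odd, hence F is even. F replaces
  the clamped extension, which need not be smooth at L.\<close>

lemma even_extension_antiderivative:
  assumes L: "L > 0" and N: "neumann L P f g"
    and h: "h = (\<lambda>y. even_ext L g y + even_ext L P y * even_ext L f y)" and ch: "continuous_on UNIV h"
  shows "\<exists>F1 F. (\<forall>y. (F1 has_real_derivative h y) (at y)) \<and> (\<forall>y. (F has_real_derivative F1 y) (at y))
    \<and> (\<forall>y. \<bar>y\<bar> \<le> L \<longrightarrow> F y = even_ext L f y)"
proof -
  obtain f1 where f1: "f1 0 = 0" "\<And>x. x \<in> {0..L} \<Longrightarrow> (f has_real_derivative f1 x) (at x within {0..L})"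
      "\<And>x. x \<in> {0..L} \<Longrightarrow> (f1 has_real_derivative g x + P x * f x) (at x within {0..L})"
    using N unfolding neumann_def by blast
  obtain F1 where F1: "F1 0 = 0" "\<And>y. (F1 has_real_derivative h y) (at y)"
    using antiderivative_exists[OF ch, of 0] by auto
  have cF1: "continuous_on UNIV F1"
    by (rule DERIV_continuous_on) (use F1 has_field_derivative_at_within in blast)
  obtain F where F: "F 0 = f 0" "\<And>y. (F has_real_derivative F1 y) (at y)"
    using antiderivative_exists[OF cF1, of "f 0"] by auto
  have hx: "h x = g x + P x * f x" if "x \<in> {0..L}" for x
    using that by (simp add: h even_ext_def min_absorb2)
  have F1': "(F1 has_real_derivative g x + P x * f x) (at x within {0..L})" if "x \<in> {0..L}" for x
    using has_field_derivative_at_within[OF F1(2)] hx[OF that] by metis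
  have f1F1: "f1 x = F1 x" if "x \<in> {0..L}" for x
    by (rule DERIV_eq_on_Icc[OF f1(3) F1' _ that]) (simp_all add: f1(1) F1(1))
  have F': "(F has_real_derivative f1 x) (at x within {0..L})" if "x \<in> {0..L}" for x
    using has_field_derivative_at_within[OF F(2)] f1F1[OF that] by metis
  have "f x = F x" if "x \<in> {0..L}" for x
    by (rule DERIV_eq_on_Icc[OF f1(2) F' _ that]) (simp_all add: F(1))
  moreover have odd: "F1 (- y) = - F1 y" for y
  proof -
    have "((\<lambda>y. F1 y + F1 (- y)) has_real_derivative h y + h (- y) * - 1) (at y)" for y
      by (intro DERIV_add F1(2) DERIV_chain2[OF F1(2)]) (auto intro!: derivative_eq_intros)
    then have "((\<lambda>y. F1 y + F1 (- y)) has_real_derivative 0) (at y)" for y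
      by (simp add: h even_ext_def)
    then have "F1 y + F1 (- y) = F1 0 + F1 (- 0)"
      by (intro DERIV_isconst_all[of "\<lambda>y. F1 y + F1 (- y)" y 0]) simp
    then show ?thesis using F1(1) by simp
  qed
  moreover have "F (- y) = F y" for y
  proof -
    have "((\<lambda>y. F y - F (- y)) has_real_derivative F1 y - F1 (- y) * - 1) (at y)" for y
      by (intro DERIV_diff F(2) DERIV_chain2[OF F(2)]) (auto intro!: derivative_eq_intros)
    then have "((\<lambda>y. F y - F (- y)) has_real_derivative 0) (at y)" for y
      by (simp add: odd)
    then have "F y - F (- y) = F 0 - F (- 0)"
      by (intro DERIV_isconst_all[of "\<lambda>y. F y - F (- y)" y 0]) simp
    then show ?thesis by simp
  qed
  ultimately have "F y = even_ext L f y" if "\<bar>y\<bar> \<le> L" for y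
    using that by (cases "y \<ge> 0") (auto simp: even_ext_def min_absorb2 abs_real_def)
  with F1(2) F(2) show ?thesis by blast
qed

text \<open>The right-hand side solves the integral equation that defines the left-hand side, because
  integration in \<open>x\<close> commutes with \<^const>\<open>duhamel\<close> and with multiplication by \<open>P (y)\<close>.\<close>

lemma wave_sol_generator:
  assumes L: "L > 0" and P: "continuous_on {0..L} P" and N: "neumann L P f g"
    and xy: "0 \<le> x" "x + \<bar>y\<bar> \<le> L"
  shows "wave_sol L P f x y = even_ext L f y + ray_int 0 (ray_int 0 (wave_sol L P g)) x y"
proof -
  define p where "p = even_ext L P"
  have f: "continuous_on {0..L} f" by (rule neumann_continuous[OF N])
  have g: "continuous_on {0..L} g" using N by (simp add: neumann_def)
  note cP = continuous_even_ext[OF L P, folded p_def]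
  note cf = continuous_even_ext[OF L f] and cg = continuous_even_ext[OF L g]
  define h where "h = (\<lambda>y. even_ext L g y + even_ext L P y * even_ext L f y)"
  have ch: "continuous_on UNIV h"
    unfolding h_def by (intro continuous_intros cf cg cP[unfolded p_def])
  obtain F1 F where F1: "\<And>y. (F1 has_real_derivative h y) (at y)"
    and F: "\<And>y. (F has_real_derivative F1 y) (at y)" and Ff: "\<And>y. \<bar>y\<bar> \<le> L \<Longrightarrow> F y = even_ext L f y"
    using even_extension_antiderivative[OF L N h_def ch] by auto
  have cF: "continuous_on UNIV F"
    by (rule DERIV_continuous_on) (use F has_field_derivative_at_within in blast)
  define Th where "Th = wave_sol L P g"
  have Th: "jcont Th" unfolding Th_def by (rule jcont_wave_sol[OF L P g])
  have pTh: "jcont (\<lambda>s z. p z * Th s z)" by (rule jcont_mult_snd[OF cP Th])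
  define J where "J G = ray_int 0 (ray_int 0 G)" for G
  have cJ: "jcont (J G)" if "jcont G" for G unfolding J_def by (intro jcont_ray_int that)
  have J_lin: "J (\<lambda>s z. a * G s z + b * K s z) = (\<lambda>x y. a * J G x y + b * J K x y)"
    if "jcont G" "jcont K" for G K a b
    unfolding J_def using that by (simp add: ray_int_lin jcont_ray_int)
  have J_cong: "J G x y = J K x y" if "\<And>x y. 0 \<le> x \<Longrightarrow> G x y = K x y" "0 \<le> x" for G K x y
    unfolding J_def by (intro ray_int_cong that) auto
  have pJ: "(\<lambda>s z. p z * J Th s z) = J (\<lambda>s z. p z * Th s z)"
  proof (intro ext)
    fix s z
    have "ray_int 0 (\<lambda>s z. p z * G s z) = (\<lambda>s z. p z * ray_int 0 G s z)" if "jcont G" for G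
      using that by (intro ext ray_int_mult_left) auto
    then show "p z * J Th s z = J (\<lambda>s z. p z * Th s z) s z"
      unfolding J_def by (simp add: Th jcont_ray_int)
  qed
  \<comment> \<open>J is made of rays with c = 0 and \<open>duhamel\<close> of rays with c = 1 and c
    = - 1; all of these commute.\<close>
  have DJ: "duhamel (J G) = J (duhamel G)" if "jcont G" for G
  proof -
    have "ray_int c (J G) = J (ray_int c G)" if "jcont G" for c G
    proof -
      have "ray_int c (ray_int 0 K) = ray_int 0 (ray_int c K)" if "jcont K" for K
        by (intro ext ray_int_commute that)
      then show ?thesis unfolding J_def using that by (simp add: jcont_ray_int)
    qed
    then show ?thesis using that by (simp add: duhamel_def jcont_ray_int)
  qed
  have pf: "continuous_on UNIV (\<lambda>z. p z * even_ext L f z)" by (intro continuous_intros cP cf)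
  have jF: "jcont (\<lambda>s z. F z)"
    unfolding case_prod_unfold by (rule continuous_on_compose2[OF cF]) (auto intro: continuous_intros)
  note jwm = jcont_wave_mean
  \<comment> \<open>The claimed right-hand side, with F in place of the clamped extension so that
    d'Alembert's formula applies. Uniqueness will identify it with the solution.\<close>
  define R where "R x y = F y + J Th x y" for x y
  have jR: "jcont R"
    unfolding R_def case_prod_unfold
    using continuous_on_add[OF jF cJ[OF Th]] by (simp add: case_prod_unfold)
  have R: "R s z + duhamel (\<lambda>s z. p z * R s z) s z = wave_mean (even_ext L f) s z"
    if sz: "0 \<le> s" "s + \<bar>z\<bar> \<le> L" for s z
  proof -
    have "duhamel (\<lambda>s z. p z * R s z)
        = duhamel (\<lambda>s z. 1 * (p z * F z) + 1 * (p z * J Th s z))"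
      by (simp add: R_def algebra_simps)
    also have "\<dots> = (\<lambda>x y. 1 * duhamel (\<lambda>s z. p z * F z) x y + 1 * duhamel (\<lambda>s z. p z * J Th s z) x y)"
      by (intro duhamel_lin jcont_mult_snd cP jF cJ Th)
    finally have "duhamel (\<lambda>s z. p z * R s z) s z
        = duhamel (\<lambda>s z. p z * F z) s z + J (duhamel (\<lambda>s z. p z * Th s z)) s z"
      by (simp add: pJ DJ[OF pTh])
    \<comment> \<open>Here the triangle matters: F and the extension of f are known to agree only
      for \<open>\<bar>z\<bar> \<le> L\<close>, and the backward triangle stays in that
      range.\<close>
    moreover have "duhamel (\<lambda>s z. p z * F z) s z = duhamel (\<lambda>s z. p z * even_ext L f z) s z"
      by (rule duhamel_cong) (use sz Ff in auto)
    moreover have "\<dots> = J (wave_mean (\<lambda>z. p z * even_ext L f z)) s z"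
      unfolding J_def by (rule duhamel_stationary[OF pf sz(1)])
    \<comment> \<open>Inserting the equation for Th cancels the Duhamel term of R that came from Th;
      the sources g and p f then add up to h.\<close>
    moreover have "J Th s z = J (\<lambda>s z. 1 * wave_mean (even_ext L g) s z + (-1) * duhamel (\<lambda>s z. p z * Th s z) s z) s z"
      by (rule J_cong[OF _ sz(1)]) (simp add: Th_def p_def wave_sol_eq[OF L P g])
    moreover have "\<dots> = J (wave_mean (even_ext L g)) s z - J (duhamel (\<lambda>s z. p z * Th s z)) s z"
      by (subst J_lin) (auto intro!: jwm cg jcont_duhamel pTh)
    moreover have "J (wave_mean h) s z
        = J (\<lambda>s z. 1 * wave_mean (even_ext L g) s z + 1 * wave_mean (\<lambda>z. p z * even_ext L f z) s z) s z"
      by (rule J_cong[OF _ sz(1)]) (simp add: wave_mean_def h_def p_def add_divide_distrib)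
    moreover have "\<dots> = J (wave_mean (even_ext L g)) s z + J (wave_mean (\<lambda>z. p z * even_ext L f z)) s z"
      by (subst J_lin) (auto intro!: jwm cg pf)
    moreover have "J (wave_mean h) s z = wave_mean F s z - F z"
      unfolding J_def by (rule dAlembert[OF F1 F sz(1)])
    moreover have "wave_mean F s z = wave_mean (even_ext L f) s z"
      unfolding wave_mean_def using sz by (simp add: Ff)
    ultimately show ?thesis by (simp add: R_def)
  qed
  define W where "W x y = 1 * wave_sol L P f x y + (- 1) * R x y" for x y
  note jw = jcont_wave_sol[OF L P f]
  have W: "jcont W"
    unfolding W_def case_prod_unfold by (intro continuous_intros jcont_compose[OF jw] jcont_compose[OF jR])
  have "W x y = 0"
  proof (rule wave_sol_unique[OF L P W _ xy])
    fix s z :: real assume sz: "0 \<le> s" "s + \<bar>z\<bar> \<le> L"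
    have "duhamel (\<lambda>s z. p z * W s z) = duhamel (\<lambda>s z. 1 * (p z * wave_sol L P f s z) + (- 1) * (p z * R s z))"
      by (simp add: W_def algebra_simps)
    also have "\<dots> = (\<lambda>x y. 1 * duhamel (\<lambda>s z. p z * wave_sol L P f s z) x y + (- 1) * duhamel (\<lambda>s z. p z * R s z) x y)"
      by (intro duhamel_lin jcont_mult_snd cP jw jR)
    finally have "duhamel (\<lambda>s z. p z * W s z) s z
        = duhamel (\<lambda>s z. p z * wave_sol L P f s z) s z - duhamel (\<lambda>s z. p z * R s z) s z" by simp
    with R[OF sz] wave_sol_eq[OF L P f sz(1), of z]
    show "W s z + duhamel (\<lambda>s z. even_ext L P z * W s z) s z = 0"
      by (simp add: W_def flip: p_def)
  qed
  then show ?thesis using xy Ff[of y] by (simp add: W_def R_def J_def Th_def)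
qed

section \<open>The transmutation operator\<close>

definition transm :: "real \<Rightarrow> (real \<Rightarrow> real) \<Rightarrow> (real \<Rightarrow> real) \<Rightarrow> real \<Rightarrow> real" where
  "transm L P f x = wave_sol L P f x 0"

lemma even_ext_cong: "L > 0 \<Longrightarrow> (\<And>x. x \<in> {0..L} \<Longrightarrow> f x = g x) \<Longrightarrow> even_ext L f = even_ext L g"
  unfolding even_ext_def by (intro ext) auto

lemma transm_cong:
  assumes "L > 0" "\<And>x. x \<in> {0..L} \<Longrightarrow> f x = g x"
  shows "transm L P f = transm L P g"
proof -
  have "even_ext L f = even_ext L g" by (rule even_ext_cong[OF assms])
  then show ?thesis unfolding transm_def[abs_def] wave_sol_def by simp
qed

lemma ray_int_nonpos: "x \<le> 0 \<Longrightarrow> ray_int c F x y = 0"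
  unfolding ray_int_def by (cases "x = 0") auto

lemma transm_0:
  assumes "L > 0" "continuous_on {0..L} P" "continuous_on {0..L} f"
  shows "transm L P f 0 = f 0"
  using wave_sol_eq[OF assms, of 0 0] assms(1)
  by (simp add: transm_def wave_mean_def duhamel_def ray_int_nonpos even_ext_def)

lemma continuous_transm:
  assumes "L > 0" "continuous_on {0..L} P" "continuous_on {0..L} f"
  shows "continuous_on S (transm L P f)"
  unfolding transm_def by (intro jcont_compose[OF jcont_wave_sol[OF assms]] continuous_intros)

lemma transm_bound:
  assumes "L > 0" "continuous_on {0..L} P" "continuous_on {0..L} f"
    and M: "\<And>x. x \<in> {0..L} \<Longrightarrow> \<bar>P x\<bar> \<le> M" and B: "\<And>x. x \<in> {0..L} \<Longrightarrow> \<bar>f x\<bar> \<le> B"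
    and x: "x \<in> {0..L}"
  shows "\<bar>transm L P f x\<bar> \<le> 2 * B * exp ((M + 1) * L)"
proof -
  have "0 \<le> M" "0 \<le> B" using M[of x] B[of x] x by auto
  then have "2 * B * exp ((M + 1) * x) \<le> 2 * B * exp ((M + 1) * L)"
    using x by (intro mult_left_mono) (auto intro!: mult_left_mono)
  with wave_sol_bound[OF assms(1-3) M B, of x 0] x show ?thesis by (simp add: transm_def)
qed

text \<open>As \<open>wave_sol\<close> is a choice, linearity has to come from uniqueness: the
  difference W solves the homogeneous integral equation.\<close>

lemma transm_lin:
  assumes L: "L > 0" and P: "continuous_on {0..L} P"
    and f: "continuous_on {0..L} f" and g: "continuous_on {0..L} g" and x: "x \<ge> 0"
  shows "transm L P (\<lambda>x. a * f x + b * g x) x = a * transm L P f x + b * transm L P g x"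
proof -
  define p where "p = even_ext L P"
  have fg: "continuous_on {0..L} (\<lambda>x. a * f x + b * g x)" by (intro continuous_intros f g)
  note cP = continuous_even_ext[OF L P, folded p_def]
  note j = jcont_wave_sol[OF L P f] jcont_wave_sol[OF L P g] jcont_wave_sol[OF L P fg]
  define V where "V x y = a * wave_sol L P f x y + b * wave_sol L P g x y" for x y
  have jV: "jcont V"
    unfolding V_def case_prod_unfold by (intro continuous_intros jcont_compose[OF j(1)] jcont_compose[OF j(2)])
  define W where "W x y = 1 * wave_sol L P (\<lambda>x. a * f x + b * g x) x y + (- 1) * V x y" for x y
  have jW: "jcont W"
    unfolding W_def case_prod_unfold by (intro continuous_intros jcont_compose[OF j(3)] jcont_compose[OF jV])
  have "W x 0 = 0"
  proof (rule wave_sol_unique[OF L P jW _ x order_refl])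
    fix s z :: real assume s: "0 \<le> s"
    have "duhamel (\<lambda>s z. p z * W s z) = duhamel (\<lambda>s z. 1 * (p z * wave_sol L P (\<lambda>x. a * f x + b * g x) s z) + (- 1) * (p z * V s z))"
      by (simp add: W_def algebra_simps)
    also have "\<dots> = (\<lambda>x y. 1 * duhamel (\<lambda>s z. p z * wave_sol L P (\<lambda>x. a * f x + b * g x) s z) x y
        + (- 1) * duhamel (\<lambda>s z. p z * V s z) x y)"
      by (intro duhamel_lin jcont_mult_snd cP j jV)
    also have "(\<lambda>s z. p z * V s z) = (\<lambda>s z. a * (p z * wave_sol L P f s z) + b * (p z * wave_sol L P g s z))"
      by (simp add: V_def algebra_simps)
    also have "duhamel \<dots> = (\<lambda>x y. a * duhamel (\<lambda>s z. p z * wave_sol L P f s z) x y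
        + b * duhamel (\<lambda>s z. p z * wave_sol L P g s z) x y)"
      by (intro duhamel_lin jcont_mult_snd cP j)
    finally have "duhamel (\<lambda>s z. p z * W s z) s z
        = duhamel (\<lambda>s z. p z * wave_sol L P (\<lambda>x. a * f x + b * g x) s z) s z
        - (a * duhamel (\<lambda>s z. p z * wave_sol L P f s z) s z + b * duhamel (\<lambda>s z. p z * wave_sol L P g s z) s z)"
      by simp
    moreover have "wave_mean (even_ext L (\<lambda>x. a * f x + b * g x)) s z
        = a * wave_mean (even_ext L f) s z + b * wave_mean (even_ext L g) s z"
      by (simp add: wave_mean_def even_ext_def field_simps)
    moreover have distr: "k * wave_sol L P e s z + k * duhamel (\<lambda>s z. p z * wave_sol L P e s z) s z = k * wave_mean (even_ext L e) s z"
      if "continuous_on {0..L} e" for k e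
      using wave_sol_eq[OF L P that s, of z] by (simp add: p_def flip: distrib_left)
    ultimately show "W s z + duhamel (\<lambda>s z. even_ext L P z * W s z) s z = 0"
      using distr[OF f, of a] distr[OF g, of b] distr[OF fg, of 1]
      by (simp add: W_def[of s z] V_def[of s z] flip: p_def)
  qed
  then show ?thesis by (simp add: W_def V_def transm_def)
qed

text \<open>The intertwining relation. On the line y = 0, \<open>wave_sol_generator\<close> writes
  \<open>transm L P f\<close> as f 0 plus a double integral in x of \<open>transm L P g\<close>, so
  the fundamental theorem of calculus in x suffices.\<close>

lemma neumann_transm:
  assumes L: "L > 0" and P: "continuous_on {0..L} P" and N: "neumann L P f g"
  shows "neumann L (\<lambda>_. 0) (transm L P f) (transm L P g)"
proof -
  have g: "continuous_on {0..L} g" using N by (simp add: neumann_def)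
  define Th where "Th = wave_sol L P g"
  have Th: "jcont Th" unfolding Th_def by (rule jcont_wave_sol[OF L P g])
  define V1 where "V1 x = ray_int 0 Th x 0" for x
  have V1: "(V1 has_real_derivative transm L P g x + 0 * transm L P f x) (at x within {0..L})"
    if "x \<in> {0..L}" for x
    using ray_int_0_has_derivative[OF Th that, of 0] by (simp add: V1_def[abs_def] transm_def Th_def)
  have V: "(transm L P f has_real_derivative V1 x) (at x within {0..L})" if x: "x \<in> {0..L}" for x
  proof -
    have "((\<lambda>x. f 0 + ray_int 0 (ray_int 0 Th) x 0) has_real_derivative V1 x) (at x within {0..L})"
      using DERIV_add[OF DERIV_const ray_int_0_has_derivative[OF jcont_ray_int[OF Th] x, of 0 0]]
      by (simp add: V1_def)
    from this zero_less_one x show ?thesis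
      by (rule has_field_derivative_transform_within)
        (use wave_sol_generator[OF L P N, of _ 0] L in \<open>auto simp: transm_def Th_def even_ext_def\<close>)
  qed
  show ?thesis
    unfolding neumann_def
    using V V1 continuous_transm[OF L P g] by (intro conjI exI[of _ V1]) (auto simp: V1_def ray_int_nonpos)
qed

text \<open>The arguments of \<open>even_ext L r\<close> sweep a subinterval of \<open>[-X, X]\<close> at speed
  \<open>\<bar>c - d\<bar> \<ge> 1\<close>; this turns pointwise bounds into \<open>L\<^sup>1\<close> bounds.\<close>

lemma ray_int_travelling_le:
  assumes L: "L > 0" and r: "continuous_on {0..L} r" "\<And>x. x \<in> {0..L} \<Longrightarrow> r x \<ge> 0"
    and cd: "\<bar>c\<bar> \<le> 1" "\<bar>d\<bar> \<le> 1" "\<bar>c - d\<bar> \<ge> 1"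
    and X: "X \<in> {0..L}" and sz: "0 \<le> s" "s + \<bar>z\<bar> \<le> X"
  shows "ray_int c (\<lambda>s z. even_ext L r (z + d * s)) s z \<le> 2 * integral {0..X} r"
proof -
  define R where "R = even_ext L r"
  have cR: "continuous_on UNIV R" unfolding R_def by (rule continuous_even_ext[OF L r(1)])
  have R0: "R y \<ge> 0" for y unfolding R_def even_ext_def by (intro r(2) even_ext_range L)
  obtain K where K: "K 0 = 0" "\<And>y. (K has_real_derivative R y) (at y)"
    using antiderivative_exists[OF cR, of 0] by auto
  have mono: "K a \<le> K b" if "a \<le> b" for a b
    by (rule DERIV_nonneg_imp_nondecreasing[OF that]) (use K R0 in blast)
  have odd: "K (- y) = - K y" for y
  proof -
    have "((\<lambda>y. K y + K (- y)) has_real_derivative R y + R (- y) * - 1) (at y)" for y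
      by (intro DERIV_add K(2) DERIV_chain2[OF K(2)]) (auto intro!: derivative_eq_intros)
    then have "((\<lambda>y. K y + K (- y)) has_real_derivative 0) (at y)" for y
      by (simp add: R_def even_ext_def)
    then have "K y + K (- y) = K 0 + K (- 0)"
      by (intro DERIV_isconst_all[of "\<lambda>y. K y + K (- y)" y 0]) simp
    then show ?thesis using K(1) by simp
  qed
  have "((\<lambda>x. R x) has_integral (K X - K 0)) {0..X}"
    by (rule fundamental_theorem_of_calculus)
      (use X K in \<open>auto simp flip: has_real_derivative_iff_has_vector_derivative
        intro: has_field_derivative_at_within\<close>)
  moreover have "integral {0..X} R = integral {0..X} r"
    by (rule integral_cong) (use X in \<open>auto simp: R_def even_ext_def min_absorb2\<close>)
  ultimately have KX: "K X = integral {0..X} r" using K(1) by (simp add: has_integral_iff)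
  \<comment> \<open>K is nondecreasing and odd, so its oscillation over [- X, X] is at most 2 K
    X.\<close>
  have bd: "\<bar>K y\<bar> \<le> K X" if "\<bar>y\<bar> \<le> X" for y
    using mono[of y X] mono[of "- X" y] odd[of X] that by (simp add: abs_le_iff)
  \<comment> \<open>The speed at which the argument of R moves along the ray; dividing by it is
    harmless since its modulus is at least 1.\<close>
  define e where "e = c - d"
  have e: "\<bar>e\<bar> \<ge> 1" using cd by (simp add: e_def)
  have "ray_int c (\<lambda>s z. R (z + d * s)) s z = K (z + d * s + e * s) / e - K (z + d * s + e * 0) / e"
  proof (rule ray_int_FTC[OF sz(1)])
    fix t
    have "((\<lambda>t. K (z + d * s + e * t)) has_real_derivative R (z + d * s + e * t) * e) (at t within {0..s})"
      by (rule DERIV_chain2[OF K(2)]) (auto intro!: derivative_eq_intros)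
    from DERIV_cdivide[OF this, of e] e
    have "((\<lambda>t. K (z + d * s + e * t) / e) has_real_derivative R (z + d * s + e * t)) (at t within {0..s})"
      by auto
    moreover have "z + d * s + e * t = z + c * t + d * (s - t)" by (simp add: e_def algebra_simps)
    ultimately show "((\<lambda>t. K (z + d * s + e * t) / e) has_real_derivative R (z + c * t + d * (s - t))) (at t within {0..s})"
      by simp
  qed
  also have "\<dots> = (K (z + c * s) - K (z + d * s)) / e"
    by (simp add: e_def algebra_simps diff_divide_distrib)
  also have "\<dots> \<le> \<bar>K (z + c * s) - K (z + d * s)\<bar> / \<bar>e\<bar>"
    by (metis abs_divide abs_ge_self)
  also have "\<dots> \<le> \<bar>K (z + c * s) - K (z + d * s)\<bar> / 1"
    by (rule divide_left_mono) (use e in auto)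
  also have "\<dots> \<le> 2 * K X"
  proof -
    have "\<bar>k * s\<bar> \<le> s" if "\<bar>k\<bar> \<le> 1" for k
      using that sz(1) by (simp add: abs_mult mult_left_le_one_le)
    from this[OF cd(1)] this[OF cd(2)] sz have "\<bar>z + c * s\<bar> \<le> X" "\<bar>z + d * s\<bar> \<le> X"
      by (smt (verit))+
    from bd[OF this(1)] bd[OF this(2)] show ?thesis by (simp add: abs_le_iff)
  qed
  finally show ?thesis by (simp add: KX R_def)
qed

lemma ray_int_abs_le:
  assumes F: "jcont F" and G: "jcont G" and x: "0 \<le> x"
    and le: "\<And>s. 0 \<le> s \<Longrightarrow> s \<le> x \<Longrightarrow> \<bar>F (x - s) (y + c * s)\<bar> \<le> G (x - s) (y + c * s)"
  shows "\<bar>ray_int c F x y\<bar> \<le> ray_int c G x y"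
proof -
  have "norm (ray_int c F x y) \<le> ray_int c G x y"
    unfolding ray_int_def
    by (rule integral_norm_bound_integral) (use le in \<open>auto intro!: ray_integrable F G\<close>)
  then show ?thesis by simp
qed

text \<open>A wave that is constant along one characteristic is averaged only by integrating along
  the other. \<open>ray_int_commute\<close> lets a transversal direction c be the inner one, giving
  2 I; the outer integral adds a factor of at most L.\<close>

lemma duhamel_travelling_le:
  assumes L: "L > 0" and r: "continuous_on {0..L} r" "\<And>x. x \<in> {0..L} \<Longrightarrow> r x \<ge> 0"
    and d: "d \<in> {- 1, 0, 1}" and F: "jcont F"
    and le: "\<And>s z. 0 \<le> s \<Longrightarrow> s + \<bar>z\<bar> \<le> X \<Longrightarrow> \<bar>F s z\<bar> \<le> even_ext L r (z + d * s)"
    and X: "X \<in> {0..L}" and sz: "0 \<le> s" "s + \<bar>z\<bar> \<le> X"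
  shows "\<bar>duhamel F s z\<bar> \<le> 2 * L * integral {0..X} r"
proof -
  define I where "I = integral {0..X} r"
  have jR: "jcont (\<lambda>s z. even_ext L r (z + d * s))"
    unfolding case_prod_unfold
    by (rule continuous_on_compose2[OF continuous_even_ext[OF L r(1)]]) (auto intro!: continuous_intros)
  have "\<bar>ray_int (- c) (ray_int c F) s z\<bar> \<le> 2 * L * I"
    if c: "\<bar>c\<bar> = 1" "\<bar>c - d\<bar> \<ge> 1" for c
  proof -
    have d1: "\<bar>d\<bar> \<le> 1" using d by auto
    have pt: "\<bar>ray_int c F s z\<bar> \<le> 2 * I" if "0 \<le> s" "s + \<bar>z\<bar> \<le> X" for s z
    proof -
      have "\<bar>ray_int c F s z\<bar> \<le> ray_int c (\<lambda>s z. even_ext L r (z + d * s)) s z"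
      proof (rule ray_int_abs_le[OF F jR that(1)])
        fix t assume t: "0 \<le> t" "t \<le> s"
        have "\<bar>c * t\<bar> = t" using c t by (simp add: abs_mult)
        then have "s - t + \<bar>z + c * t\<bar> \<le> X" using that by linarith
        then show "\<bar>F (s - t) (z + c * t)\<bar> \<le> even_ext L r (z + c * t + d * (s - t))"
          using t by (intro le) auto
      qed
      also have "\<dots> \<le> 2 * I"
        unfolding I_def by (rule ray_int_travelling_le[OF L r _ d1 c(2) X that]) (use c in auto)
      finally show ?thesis .
    qed
    have "\<bar>ray_int (- c) (ray_int c F) s z\<bar> \<le> ray_int (- c) (\<lambda>s z. 2 * I) s z"
    proof (rule ray_int_abs_le[OF jcont_ray_int[OF F] _ sz(1)])
      fix t assume t: "0 \<le> t" "t \<le> s"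
      have "\<bar>- c * t\<bar> = t" using c t by (simp add: abs_mult)
      then have "s - t + \<bar>z + - c * t\<bar> \<le> X" using sz by linarith
      then show "\<bar>ray_int c F (s - t) (z + - c * t)\<bar> \<le> 2 * I" using t by (intro pt) auto
    qed (simp add: case_prod_unfold)
    also have "\<dots> = s * (2 * I)" using sz by (simp add: ray_int_def)
    also have "\<dots> \<le> L * (2 * I)"
    proof (rule mult_right_mono)
      show "s \<le> L" using sz X by auto
      show "0 \<le> 2 * I" using pt[OF sz] by linarith
    qed
    finally show ?thesis by simp
  qed
  note bd = this
  show ?thesis
  \<comment> \<open>The direction c = 1 is transversal to d = - 1; for d = 0 and d = 1 the choice c
    = - 1 works.\<close>
  proof (cases "d = - 1")
    case True
    then show ?thesis
      using bd[of 1] unfolding duhamel_def I_def ray_int_commute[OF F, of 1 "- 1" s z] by simp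
  next
    case False
    then show ?thesis
      using bd[of "- 1"] d unfolding duhamel_def I_def by auto
  qed
qed

text \<open>The identity is the d'Alembert part, which on y = 0 averages the even extension to h x.
  The remainder Z solves an integral equation whose source is q times two travelling waves, so the
  integral of \<open>\<bar>h\<bar>\<close> controls it. The factor 4 is 2 from Gronwall times 2 from
  the travelling estimate.\<close>

lemma transm_minus_id_bound:
  assumes L: "L > 0" and Q: "continuous_on {0..L} Q" "\<And>x. x \<in> {0..L} \<Longrightarrow> \<bar>Q x\<bar> \<le> M"
    and h: "continuous_on {0..L} h" and x: "x \<in> {0..L}"
  shows "\<bar>transm L Q h x - h x\<bar> \<le> 4 * L * M * exp ((M + 1) * L) * integral {0..x} (\<lambda>y. \<bar>h y\<bar>)"
proof -
  define q where "q = even_ext L Q"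
  have M: "M \<ge> 0" using Q(2)[OF x] by linarith
  have qM: "\<bar>q z\<bar> \<le> M" for z unfolding q_def even_ext_def by (intro Q(2) even_ext_range L)
  define I where "I = integral {0..x} (\<lambda>y. \<bar>h y\<bar>)"
  note cq = continuous_even_ext[OF L Q(1), folded q_def] and ch = continuous_even_ext[OF L h]
  note jT = jcont_wave_sol[OF L Q(1) h]
  define Z where "Z = duhamel (\<lambda>s z. q z * wave_sol L Q h s z)"
  have jZ: "jcont Z" unfolding Z_def by (intro jcont_duhamel jcont_mult_snd cq jT)
  have T: "wave_sol L Q h s z = wave_mean (even_ext L h) s z - Z s z" if "0 \<le> s" for s z
    using wave_sol_eq[OF L Q(1) h that, of z] by (simp add: Z_def q_def)
  define F where "F d s z = q z * even_ext L h (z + d * s)" for d s z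
  have jh: "jcont (\<lambda>s z. even_ext L h (z + d * s))" for d
    unfolding case_prod_unfold
    by (rule continuous_on_compose2[OF ch]) (auto intro!: continuous_intros)
  have jF: "jcont (F d)" for d
    unfolding F_def by (intro jcont_mult_snd cq jh)
  have cr: "continuous_on {0..L} (\<lambda>y. M * \<bar>h y\<bar>)" by (intro continuous_intros h)
  have F: "\<bar>duhamel (F d) s z\<bar> \<le> 2 * L * (M * I)"
    if "d \<in> {- 1, 1}" "0 \<le> s" "s + \<bar>z\<bar> \<le> x" for d s z
  proof -
    have "\<bar>duhamel (F d) s z\<bar> \<le> 2 * L * integral {0..x} (\<lambda>y. M * \<bar>h y\<bar>)"
    proof (rule duhamel_travelling_le[OF L cr _ _ jF _ x that(2,3)])
      show "\<bar>F d s z\<bar> \<le> even_ext L (\<lambda>y. M * \<bar>h y\<bar>) (z + d * s)" for s z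
        unfolding F_def by (simp add: abs_mult even_ext_def mult_right_mono qM)
    qed (use that M in auto)
    then show ?thesis by (simp add: I_def)
  qed
  have "\<bar>Z x 0\<bar> \<le> 2 * (2 * L * (M * I)) * exp ((M + 1) * x)"
  proof (rule wave_sol_gronwall[OF L Q(1) jZ Q(2), where X = x])
    fix s z :: real assume sz: "0 \<le> s" "s + \<bar>z\<bar> \<le> x"
    have "Z s z = duhamel (\<lambda>s z. 1 * (1 / 2 * F 1 s z + 1 / 2 * F (- 1) s z) + (- 1) * (q z * Z s z)) s z"
      unfolding Z_def[THEN fun_cong, THEN fun_cong, of s z]
      by (rule duhamel_cong[OF sz(1)])
        (simp add: T F_def wave_mean_def field_simps)
    also have "\<dots> = 1 / 2 * duhamel (F 1) s z + 1 / 2 * duhamel (F (- 1)) s z - duhamel (\<lambda>s z. q z * Z s z) s z"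
    proof -
      have jS: "jcont (\<lambda>s z. 1 / 2 * F 1 s z + 1 / 2 * F (- 1) s z)"
        unfolding case_prod_unfold by (intro continuous_intros jcont_compose[OF jF])
      show ?thesis
        unfolding duhamel_lin[OF jS jcont_mult_snd[OF cq jZ]] duhamel_lin[OF jF jF] by simp
    qed
    finally show "\<bar>Z s z + duhamel (\<lambda>s z. even_ext L Q z * Z s z) s z\<bar> \<le> 2 * L * (M * I)"
      using F[OF _ sz, of 1] F[OF _ sz, of "- 1"] by (simp add: abs_le_iff flip: q_def)
  qed (use x in auto)
  also have "\<dots> \<le> 2 * (2 * L * (M * I)) * exp ((M + 1) * L)"
  proof (rule mult_left_mono)
    show "exp ((M + 1) * x) \<le> exp ((M + 1) * L)"
      using x M by (auto intro!: mult_left_mono)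
    have "0 \<le> I" unfolding I_def by (rule integral_nonneg)
      (use x in \<open>auto intro!: integrable_continuous_real continuous_intros continuous_on_subset[OF h]\<close>)
    then show "0 \<le> 2 * (2 * L * (M * I))" using L M by simp
  qed
  finally show ?thesis
    using T[of x 0] x by (simp add: transm_def wave_mean_def even_ext_def min_absorb2 I_def mult_ac)
qed

text \<open>The difference W of the two solutions has \<open>W + duhamel (p W)\<close> equal to the
  Duhamel integral of q - p times the solution for Q, a source bounded by a stationary multiple of
  \<open>\<bar>P - Q\<bar>\<close>. The factor 8 is 2 each from Gronwall, the travelling estimate
  and the bound on the solution for Q; the first and the last also contribute an exponential
  each.\<close>

lemma transm_diff_bound:
  assumes L: "L > 0" and P: "continuous_on {0..L} P" "\<And>x. x \<in> {0..L} \<Longrightarrow> \<bar>P x\<bar> \<le> M"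
    and Q: "continuous_on {0..L} Q" "\<And>x. x \<in> {0..L} \<Longrightarrow> \<bar>Q x\<bar> \<le> M"
    and g: "continuous_on {0..L} g" "\<And>x. x \<in> {0..L} \<Longrightarrow> \<bar>g x\<bar> \<le> B"
    and x: "x \<in> {0..L}"
  shows "\<bar>transm L P g x - transm L Q g x\<bar>
    \<le> 8 * L * B * exp ((M + 1) * L) * exp ((M + 1) * L) * integral {0..x} (\<lambda>y. \<bar>P y - Q y\<bar>)"
proof -
  define p q where "p = even_ext L P" and "q = even_ext L Q"
  have M: "M \<ge> 0" using Q(2)[OF x] by linarith
  have B: "B \<ge> 0" using g(2)[OF x] by linarith
  define E where "E = exp ((M + 1) * L)"
  have E: "exp ((M + 1) * s) \<le> E" if "s \<le> L" for s
    using that M by (auto simp: E_def intro!: mult_left_mono)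
  have E0: "E \<ge> 0" by (simp add: E_def)
  define I where "I = integral {0..x} (\<lambda>y. \<bar>P y - Q y\<bar>)"
  note cp = continuous_even_ext[OF L P(1), folded p_def]
    and cq = continuous_even_ext[OF L Q(1), folded q_def]
  note jP = jcont_wave_sol[OF L P(1) g(1)] and jQ = jcont_wave_sol[OF L Q(1) g(1)]
  define W where "W s z = 1 * wave_sol L P g s z + (- 1) * wave_sol L Q g s z" for s z
  have jW: "jcont W"
    unfolding W_def case_prod_unfold by (intro continuous_intros jcont_compose[OF jP] jcont_compose[OF jQ])
  have cr: "continuous_on {0..L} (\<lambda>y. 2 * B * E * \<bar>P y - Q y\<bar>)" by (intro continuous_intros P Q)
  have "\<bar>W x 0\<bar> \<le> 2 * (2 * L * (2 * B * E * I)) * exp ((M + 1) * x)"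
  proof (rule wave_sol_gronwall[OF L P(1) jW P(2), where X = x])
    fix s z :: real assume sz: "0 \<le> s" "s + \<bar>z\<bar> \<le> x"
    define F where "F s z = (q z - p z) * wave_sol L Q g s z" for s z
    have jF: "jcont F"
      unfolding F_def by (intro jcont_mult_snd jQ continuous_intros cp cq)
    have "duhamel (\<lambda>s z. p z * W s z)
        = duhamel (\<lambda>s z. 1 * (p z * wave_sol L P g s z) + (- 1) * (1 * (q z * wave_sol L Q g s z) + (- 1) * F s z))"
      by (simp add: W_def F_def algebra_simps)
    also have "\<dots> = (\<lambda>x y. 1 * duhamel (\<lambda>s z. p z * wave_sol L P g s z) x y
        + (- 1) * duhamel (\<lambda>s z. 1 * (q z * wave_sol L Q g s z) + (- 1) * F s z) x y)"
    proof (rule duhamel_lin)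
      show "jcont (\<lambda>s z. 1 * (q z * wave_sol L Q g s z) + (- 1) * F s z)"
        unfolding case_prod_unfold
        by (intro continuous_intros jcont_compose[OF jcont_mult_snd[OF cq jQ]] jcont_compose[OF jF])
    qed (intro jcont_mult_snd cp jP)
    also have "duhamel (\<lambda>s z. 1 * (q z * wave_sol L Q g s z) + (- 1) * F s z)
        = (\<lambda>x y. 1 * duhamel (\<lambda>s z. q z * wave_sol L Q g s z) x y + (- 1) * duhamel F x y)"
      by (intro duhamel_lin jcont_mult_snd cq jQ jF)
    finally have "duhamel (\<lambda>s z. p z * W s z) s z
        = duhamel (\<lambda>s z. p z * wave_sol L P g s z) s z - duhamel (\<lambda>s z. q z * wave_sol L Q g s z) s z + duhamel F s z"
      by simp
    then have "W s z + duhamel (\<lambda>s z. even_ext L P z * W s z) s z = duhamel F s z"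
      using wave_sol_eq[OF L P(1) g(1) sz(1), of z] wave_sol_eq[OF L Q(1) g(1) sz(1), of z]
      by (simp add: W_def[of s z] flip: p_def q_def)
    moreover have "\<bar>duhamel F s z\<bar> \<le> 2 * L * integral {0..x} (\<lambda>y. 2 * B * E * \<bar>P y - Q y\<bar>)"
    proof (rule duhamel_travelling_le[OF L cr _ _ jF _ x sz, where d = 0])
      fix s z :: real assume sz: "0 \<le> s" "s + \<bar>z\<bar> \<le> x"
      have "\<bar>wave_sol L Q g s z\<bar> \<le> 2 * B * exp ((M + 1) * s)"
        by (rule wave_sol_bound[OF L Q(1) g(1) Q(2) g(2) sz(1)])
      also have "\<dots> \<le> 2 * B * E"
        using sz x B by (intro mult_left_mono E) auto
      finally have "\<bar>q z - p z\<bar> * \<bar>wave_sol L Q g s z\<bar> \<le> \<bar>q z - p z\<bar> * (2 * B * E)"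
        by (intro mult_left_mono) auto
      then show "\<bar>F s z\<bar> \<le> even_ext L (\<lambda>y. 2 * B * E * \<bar>P y - Q y\<bar>) (z + 0 * s)"
        by (simp add: F_def p_def q_def even_ext_def abs_mult abs_minus_commute mult_ac)
    qed (use B E0 in auto)
    ultimately show "\<bar>W s z + duhamel (\<lambda>s z. even_ext L P z * W s z) s z\<bar> \<le> 2 * L * (2 * B * E * I)"
      by (simp add: I_def)
  qed (use x in auto)
  also have "\<dots> \<le> 2 * (2 * L * (2 * B * E * I)) * E"
  proof (rule mult_left_mono)
    show "exp ((M + 1) * x) \<le> E" using x by (intro E) auto
    have "0 \<le> I" unfolding I_def by (rule integral_nonneg)
      (use x in \<open>auto intro!: integrable_continuous_real continuous_intros continuous_on_subset[OF P(1)]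
        continuous_on_subset[OF Q(1)]\<close>)
    then show "0 \<le> 2 * (2 * L * (2 * B * E * I))" using L M B E0 by simp
  qed
  finally show ?thesis
    by (simp add: W_def transm_def I_def E_def mult_ac)
qed

section \<open>Exponential moments\<close>

lemma zero_on_closed_Icc:
  fixes f :: "real \<Rightarrow> real"
  assumes "a < b" "continuous_on {a..b} f" "\<And>x. x \<in> {a<..<b} \<Longrightarrow> f x = 0" "x \<in> {a..b}"
  shows "f x = 0"
  using continuous_constant_on_closure[of "{a<..<b}" f 0 x] assms by simp

lemma tendsto_real_times_exp_neg:
  assumes "(s::real) > 0"
  shows "(\<lambda>n. real n * exp (- (real n * s))) \<longlonglongrightarrow> 0"
proof -
  have "\<bar>exp (- s)\<bar> < 1" using assms by simp
  from powser_times_n_limit_0[of "exp (- s)"] this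
  have "(\<lambda>n. real n * exp (- s) ^ n) \<longlonglongrightarrow> 0" by simp
  then show ?thesis by (simp flip: exp_of_nat_mult)
qed

text \<open>Mikusinski's argument: summing the hypothesis over the multiples \<open>k n\<close> of \<open>n\<close> against
  \<open>(-1)\<^sup>k\<^sup>-\<^sup>1 exp (- k n (L - c)) / k!\<close> gives the kernel \<open>1 - exp (- exp (n (c - r)))\<close>, which tends to
  the indicator of \<open>r < c\<close>, while the right-hand side tends to \<open>0\<close>.\<close>

lemma exponential_moments_zero:
  fixes b :: "real \<Rightarrow> real"
  assumes L: "L > 0" and b: "continuous_on {0..L} b"
    and le: "\<And>n::nat. n \<ge> 1 \<Longrightarrow> \<bar>integral {0..L} (\<lambda>r. exp (real n * (L - r)) * b r)\<bar> \<le> C * real n"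
    and x: "x \<in> {0..L}"
  shows "b x = 0"
proof -
  obtain B where B: "B \<ge> 0" "\<And>x. x \<in> {0..L} \<Longrightarrow> \<bar>b x\<bar> \<le> B"
    using continuous_Icc_bounded[OF b] by metis
  have C: "C \<ge> 0" using le[of 1] by simp
  have int: "(\<lambda>r. k r * b r) integrable_on {0..L}" if "continuous_on {0..L} k" for k
    by (intro integrable_continuous_real continuous_intros b that)
  have zero: "integral {0..c} b = 0" if c: "0 < c" "c < L" for c
  proof -
    define I where "I n = integral {0..L} (\<lambda>r. (1 - exp (- exp (real n * (c - r)))) * b r)" for n :: nat
    have I_le: "\<bar>I n\<bar> \<le> C * exp 1 * (real n * exp (- (real n * (L - c))))" if n: "n \<ge> 1" for n
    proof -
      \<comment> \<open>The price of moving the base point from c to L: the k-th power of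
        \<open>y r\<close> is q^k exp (k n (L - r)), so every power of y is covered by the
        hypothesis. It is small because c < L.\<close>
      define q where "q = exp (- (real n * (L - c)))"
      have q: "0 \<le> q" "q \<le> 1" using c by (auto simp: q_def)
      define y where "y r = exp (real n * (c - r))" for r
      define S where "S N r = (\<Sum>k<N. (- 1) ^ k / fact (Suc k) * y r ^ Suc k)" for N r
      have y: "0 \<le> y r" "y r \<le> exp (real n * c)" if "r \<in> {0..L}" for r
        using that by (auto simp: y_def mult_left_mono)
      have cy: "continuous_on {0..L} y" unfolding y_def by (intro continuous_intros)
      have S_lim: "(\<lambda>N. S N r) \<longlonglongrightarrow> 1 - exp (- y r)" for r
      proof -
        have "(\<lambda>k. (- y r) ^ k /\<^sub>R fact k) sums exp (- y r)" by (rule exp_converges)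
        then have "(\<lambda>k. (- y r) ^ Suc k /\<^sub>R fact (Suc k)) sums (exp (- y r) - 1)"
          by (subst sums_Suc_iff) simp
        from sums_minus[OF this]
        have "(\<lambda>k. (- 1) ^ k / fact (Suc k) * y r ^ Suc k) sums (1 - exp (- y r))"
          by (simp add: power_minus[of "y r"] field_simps)
        then show ?thesis unfolding S_def sums_def .
      qed
      have S_bd: "\<bar>S N r * b r\<bar> \<le> exp (exp (real n * c)) * B" if r: "r \<in> {0..L}" for N r
      proof -
        have "\<bar>S N r\<bar> \<le> (\<Sum>k<N. \<bar>(- 1) ^ k / fact (Suc k) * y r ^ Suc k\<bar>)"
          unfolding S_def by (rule sum_abs)
        also have "\<dots> = (\<Sum>k<N. y r ^ Suc k /\<^sub>R fact (Suc k))"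
          by (rule sum.cong) (use y[OF r] in \<open>auto simp: abs_mult power_abs field_simps\<close>)
        also have "\<dots> \<le> (\<Sum>k<Suc N. y r ^ k /\<^sub>R fact k)"
          unfolding sum.lessThan_Suc_shift by simp
        also have "\<dots> \<le> exp (y r)"
          unfolding exp_def by (rule sum_le_suminf[OF summable_exp_generic]) (use y[OF r] in auto)
        also have "\<dots> \<le> exp (exp (real n * c))" using y[OF r] by simp
        finally show ?thesis using B(2)[OF r] B(1) by (auto simp: abs_mult intro!: mult_mono)
      qed
      have lim: "(\<lambda>N. integral {0..L} (\<lambda>r. S N r * b r)) \<longlonglongrightarrow> I n"
        unfolding I_def
      proof (rule dominated_convergence(2))
        show "(\<lambda>r. S N r * b r) integrable_on {0..L}" for N
          unfolding S_def by (intro int continuous_intros cy)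
        show "(\<lambda>r. exp (exp (real n * c)) * B) integrable_on {0..L}" by (rule integrable_const_ivl)
        show "norm (S N r * b r) \<le> exp (exp (real n * c)) * B" if "r \<in> {0..L}" for N r
          using S_bd[OF that] by simp
        show "(\<lambda>N. S N r * b r) \<longlonglongrightarrow> (1 - exp (- exp (real n * (c - r)))) * b r" for r
          using tendsto_mult_right[OF S_lim] by (simp add: y_def)
      qed
      have "\<bar>integral {0..L} (\<lambda>r. S N r * b r)\<bar> \<le> C * exp 1 * (real n * q)" for N
      proof -
        have trm: "\<bar>integral {0..L} (\<lambda>r. y r ^ Suc k * b r)\<bar> \<le> q ^ Suc k * (C * real (Suc k * n))" for k
        proof -
          have "y r ^ Suc k = q ^ Suc k * exp (real (Suc k * n) * (L - r))" for r
            unfolding y_def q_def by (simp add: field_simps flip: exp_of_nat_mult exp_add power_Suc)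
          then have "integral {0..L} (\<lambda>r. y r ^ Suc k * b r)
              = q ^ Suc k * integral {0..L} (\<lambda>r. exp (real (Suc k * n) * (L - r)) * b r)"
            by (simp only: mult.assoc integral_mult_right)
          moreover have "\<bar>integral {0..L} (\<lambda>r. exp (real (Suc k * n) * (L - r)) * b r)\<bar> \<le> C * real (Suc k * n)"
            by (rule le) (use n in simp)
          ultimately show ?thesis
            using q by (simp only: abs_mult power_abs abs_of_nonneg) (intro mult_left_mono; simp)
        qed
        have "integral {0..L} (\<lambda>r. S N r * b r)
            = (\<Sum>k<N. (- 1) ^ k / fact (Suc k) * integral {0..L} (\<lambda>r. y r ^ Suc k * b r))"
          unfolding S_def sum_distrib_right mult.assoc
          by (subst integral_sum)
            (auto intro!: sum.cong int continuous_intros cy integrable_on_mult_right simp del: power_Suc)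
        also have "\<bar>\<dots>\<bar> \<le> (\<Sum>k<N. \<bar>(- 1) ^ k / fact (Suc k) * integral {0..L} (\<lambda>r. y r ^ Suc k * b r)\<bar>)"
          by (rule sum_abs)
        \<comment> \<open>The factor \<open>Suc k\<close> from the hypothesis cancels against the
          factorial; one power of q is kept and the others are bounded by 1.\<close>
        also have "\<dots> \<le> (\<Sum>k<N. (C * real n) * (q * (1 /\<^sub>R fact k)))"
        proof (rule sum_mono)
          fix k
          have "\<bar>(- 1) ^ k / fact (Suc k) * integral {0..L} (\<lambda>r. y r ^ Suc k * b r)\<bar>
              = 1 / fact (Suc k) * \<bar>integral {0..L} (\<lambda>r. y r ^ Suc k * b r)\<bar>"
            by (simp add: abs_mult power_abs)
          also have "\<dots> \<le> 1 / fact (Suc k) * (q ^ Suc k * (C * real (Suc k * n)))"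
            by (rule mult_left_mono[OF trm]) simp
          also have "\<dots> = (C * real n) * (q * (q ^ k /\<^sub>R fact k))"
            by (simp add: divide_simps del: of_nat_Suc) (simp add: algebra_simps)
          also have "\<dots> \<le> (C * real n) * (q * (1 /\<^sub>R fact k))"
            using q C by (intro mult_left_mono scaleR_left_mono) (auto intro: power_le_one)
          finally show "\<bar>(- 1) ^ k / fact (Suc k) * integral {0..L} (\<lambda>r. y r ^ Suc k * b r)\<bar>
            \<le> (C * real n) * (q * (1 /\<^sub>R fact k))" .
        qed
        also have "\<dots> = (C * real n) * (q * (\<Sum>k<N. 1 /\<^sub>R fact k))"
          by (simp only: sum_distrib_left)
        also have "(\<Sum>k<N. 1 /\<^sub>R fact k) \<le> exp (1 :: real)"
          unfolding exp_def using sum_le_suminf[OF summable_exp_generic[of "1::real"], of "{..<N}"] by simp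
        then have "(C * real n) * (q * (\<Sum>k<N. 1 /\<^sub>R fact k)) \<le> (C * real n) * (q * exp 1)"
          using q C by (intro mult_left_mono) auto
        finally show ?thesis by (simp add: mult_ac)
      qed
      then have "eventually (\<lambda>N. \<bar>integral {0..L} (\<lambda>r. S N r * b r)\<bar> \<le> C * exp 1 * (real n * q)) sequentially"
        by simp
      from tendsto_upperbound[OF tendsto_rabs[OF lim] this] show ?thesis
        by (simp add: q_def)
    qed
    have "I \<longlonglongrightarrow> 0"
    proof (rule Lim_null_comparison)
      show "\<forall>\<^sub>F n in sequentially. norm (I n) \<le> C * exp 1 * (real n * exp (- (real n * (L - c))))"
        using eventually_ge_at_top[of 1] by eventually_elim (use I_le in simp)
      show "(\<lambda>n. C * exp 1 * (real n * exp (- (real n * (L - c))))) \<longlonglongrightarrow> 0"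
        using tendsto_mult_left[OF tendsto_real_times_exp_neg[of "L - c"], of "C * exp 1"] c by simp
    qed
    \<comment> \<open>The pointwise limit takes the value 1 - exp (- 1) at r = c;
      \<open>integral_spike\<close> discards this point below.\<close>
    moreover define g where "g r = (if r < c then 1 else if r = c then 1 - exp (- 1) else 0) * b r" for r
    have "I \<longlonglongrightarrow> integral {0..L} g"
      unfolding I_def
    proof (rule dominated_convergence(2))
      show "(\<lambda>r. (1 - exp (- exp (real n * (c - r)))) * b r) integrable_on {0..L}" for n
        by (intro int continuous_intros)
      show "(\<lambda>r. B) integrable_on {0..L}" by (rule integrable_const_ivl)
      show "norm ((1 - exp (- exp (real n * (c - r)))) * b r) \<le> B" if r: "r \<in> {0..L}" for n r
      proof -
        have "\<bar>1 - exp (- exp (real n * (c - r)))\<bar> \<le> 1" by simp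
        from mult_mono[OF this B(2)[OF r]] B(1) show ?thesis by (simp add: abs_mult)
      qed
      show "(\<lambda>n. (1 - exp (- exp (real n * (c - r)))) * b r) \<longlonglongrightarrow> g r" for r
      proof -
        have seq: "filterlim (\<lambda>n. real n * s) at_top sequentially" if "s > 0" for s
          using filterlim_tendsto_pos_mult_at_top[OF tendsto_const that filterlim_real_sequentially]
          by (simp add: mult.commute)
        have "(\<lambda>n. exp (- exp (real n * (c - r))))
            \<longlonglongrightarrow> 1 - (if r < c then 1 else if r = c then 1 - exp (- 1) else 0)"
        proof (cases r c rule: linorder_cases)
          case less
          have "filterlim (\<lambda>n. exp (real n * (c - r))) at_top sequentially"
            by (rule filterlim_compose[OF exp_at_top seq]) (use less in simp)
          then have "filterlim (\<lambda>n. - exp (real n * (c - r))) at_bot sequentially"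
            by (simp add: filterlim_uminus_at_top)
          from filterlim_compose[OF exp_at_bot this] show ?thesis using less by simp
        next
          case greater
          have "filterlim (\<lambda>n. - (real n * (r - c))) at_bot sequentially"
            using seq[of "r - c"] greater by (simp add: filterlim_uminus_at_top)
          from filterlim_compose[OF exp_at_bot this]
          have "(\<lambda>n. exp (real n * (c - r))) \<longlonglongrightarrow> 0" by (simp add: algebra_simps)
          from tendsto_exp[OF tendsto_minus[OF this]] show ?thesis using greater by simp
        qed simp
        from tendsto_mult_right[OF tendsto_diff[OF tendsto_const[of 1] this], of "b r"]
        show ?thesis by (simp add: g_def)
      qed
    qed
    ultimately have "integral {0..L} g = 0" by (rule LIMSEQ_unique[rotated])
    moreover have "integral {0..L} g = integral {0..L} (\<lambda>r. if r \<in> {0..c} then b r else 0)"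
      by (rule integral_spike[of "{c}"]) (auto simp: g_def)
    moreover have "\<dots> = integral {0..c} b"
      using integral_restrict_Int[of "{0..L}" "{0..c}" b] c by (simp add: Int_absorb1)
    ultimately show ?thesis by simp
  qed
  have "b c = 0" if c: "c \<in> {0<..<L}" for c
  proof -
    have "((\<lambda>x. integral {0..x} b) has_real_derivative b c) (at c within {0..L})"
      by (rule integral_has_real_derivative[OF b]) (use c in auto)
    then have "((\<lambda>x. integral {0..x} b) has_real_derivative b c) (at c within {0<..<L})"
      by (rule DERIV_subset) auto
    then have "((\<lambda>x. integral {0..x} b) has_real_derivative b c) (at c)"
      using c by (simp add: at_within_open[of c "{0<..<L}"])
    moreover have "((\<lambda>x. integral {0..x} b) has_real_derivative 0) (at c)"
      by (rule has_field_derivative_transform_within_open[where S = "{0<..<L}" and f = "\<lambda>_. 0"])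
        (use c zero in auto)
    ultimately show ?thesis by (rule DERIV_unique)
  qed
  from zero_on_closed_Icc[OF L b this x] show ?thesis .
qed

text \<open>Testing the equation with \<open>sinh (n (L - r))\<close> bounds the exponential moments of \<open>b\<close>.\<close>

lemma resolvent_bounded_zero:
  fixes V :: "nat \<Rightarrow> real \<Rightarrow> real"
  assumes L: "L > 0" and \<delta>: "\<delta> > 0"
    and b: "continuous_on {0..L} b" and c: "continuous_on {0..L} c" "\<And>x. x \<in> {0..L} \<Longrightarrow> \<bar>c x\<bar> \<le> C"
    and V: "\<And>n. n \<ge> 1 \<Longrightarrow>
      neumann L (\<lambda>_. 0) (V n) (\<lambda>x. (real n)\<^sup>2 * V n x - b x + exp (- ((real n)\<^sup>2 * \<delta>)) * c x)"
    and V0: "\<And>n. n \<ge> 1 \<Longrightarrow> V n 0 = 0" and VL: "\<And>n. n \<ge> 1 \<Longrightarrow> \<bar>V n L\<bar> \<le> C"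
    and x: "x \<in> {0..L}"
  shows "b x = 0"
proof -
  obtain B where B: "B \<ge> 0" "\<And>x. x \<in> {0..L} \<Longrightarrow> \<bar>b x\<bar> \<le> B"
    using continuous_Icc_bounded[OF b] by metis
  have C: "C \<ge> 0" using VL[of 1] by simp
  \<comment> \<open>Completing the square bounds n L - n^2 \<delta> by L^2 / (4 \<delta>), so the
    final-time term stays bounded uniformly in n although sinh grows.\<close>
  define K where "K = C * exp (L\<^sup>2 / (4 * \<delta>)) * L"
  have K: "K \<ge> 0" using C L by (simp add: K_def)
  show ?thesis
  proof (rule exponential_moments_zero[OF L b _ x, of "2 * C + 2 * K + B * L"])
    fix n :: nat assume n: "n \<ge> 1"
    define \<epsilon> where "\<epsilon> = exp (- ((real n)\<^sup>2 * \<delta>))"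
    obtain V1 where V1: "V1 0 = 0"
      "\<And>x. x \<in> {0..L} \<Longrightarrow> (V n has_real_derivative V1 x) (at x within {0..L})"
      "\<And>x. x \<in> {0..L} \<Longrightarrow> (V1 has_real_derivative (real n)\<^sup>2 * V n x - b x + \<epsilon> * c x) (at x within {0..L})"
      using V[OF n] unfolding neumann_def \<epsilon>_def by auto
    define \<phi> where "\<phi> r = sinh (real n * (L - r))" for r
    \<comment> \<open>Green's identity: \<open>G' = \<phi> (V'' - n\<^sup>2 V)\<close>. The zero
      Cauchy data give G 0 = 0, and sinh 0 = 0, cosh 0 = 1 leave G L = n V L.\<close>
    define G where "G r = \<phi> r * V1 r + real n * cosh (real n * (L - r)) * V n r" for r
    have "(G has_real_derivative \<phi> r * (\<epsilon> * c r) - \<phi> r * b r) (at r within {0..L})" if r: "r \<in> {0..L}" for r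
      unfolding G_def \<phi>_def
      by (rule derivative_eq_intros V1(2)[OF r] V1(3)[OF r] refl | simp)+
        (simp add: algebra_simps power2_eq_square)
    then have "((\<lambda>r. \<phi> r * (\<epsilon> * c r) - \<phi> r * b r) has_integral (G L - G 0)) {0..L}"
      by (intro fundamental_theorem_of_calculus)
        (use L in \<open>auto simp flip: has_real_derivative_iff_has_vector_derivative\<close>)
    then have eq: "integral {0..L} (\<lambda>r. \<phi> r * (\<epsilon> * c r) - \<phi> r * b r) = real n * V n L"
      by (simp add: has_integral_iff G_def V1 V0[OF n] \<phi>_def)
    have c\<phi>: "continuous_on {0..L} \<phi>" unfolding \<phi>_def by (intro continuous_intros)
    have i1: "(\<lambda>r. \<phi> r * (\<epsilon> * c r)) integrable_on {0..L}"
      by (intro integrable_continuous_real continuous_intros c\<phi> c)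
    have i2: "(\<lambda>r. \<phi> r * b r) integrable_on {0..L}"
      by (intro integrable_continuous_real continuous_intros c\<phi> b)
    have i3: "(\<lambda>r. exp (- (real n * (L - r))) * b r) integrable_on {0..L}"
      by (intro integrable_continuous_real continuous_intros b)
    have "norm (integral {0..L} (\<lambda>r. \<phi> r * (\<epsilon> * c r))) \<le> integral {0..L} (\<lambda>r. C * exp (L\<^sup>2 / (4 * \<delta>)))"
    proof (rule integral_norm_bound_integral[OF i1 integrable_const_ivl])
      fix r assume r: "r \<in> {0..L}"
      have "0 \<le> \<phi> r" using r by (simp add: \<phi>_def)
      moreover have "\<phi> r \<le> exp (real n * (L - r))"
        by (simp add: \<phi>_def sinh_field_def)
          (smt (verit) exp_ge_zero field_sum_of_halves)
      moreover have "real n * (L - r) \<le> real n * L" using r by (intro mult_left_mono) auto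
      ultimately have "\<bar>\<phi> r\<bar> * \<epsilon> \<le> exp (real n * L) * \<epsilon>"
        by (intro mult_right_mono) (auto simp: \<epsilon>_def intro: order_trans)
      also have "\<dots> = exp (real n * L - (real n)\<^sup>2 * \<delta>)" by (simp add: \<epsilon>_def flip: exp_add)
      also have "real n * L - (real n)\<^sup>2 * \<delta> \<le> L\<^sup>2 / (4 * \<delta>)"
      proof -
        have "0 \<le> (2 * \<delta> * real n - L)\<^sup>2" by simp
        then have "(real n * L - (real n)\<^sup>2 * \<delta>) * (4 * \<delta>) \<le> L\<^sup>2"
          by (simp add: power2_eq_square algebra_simps)
        then show ?thesis using \<delta> by (simp add: pos_le_divide_eq)
      qed
      then have "exp (real n * L - (real n)\<^sup>2 * \<delta>) \<le> exp (L\<^sup>2 / (4 * \<delta>))" by simp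
      finally have "\<bar>\<phi> r\<bar> * \<epsilon> * \<bar>c r\<bar> \<le> exp (L\<^sup>2 / (4 * \<delta>)) * C"
        by (intro mult_mono c(2)[OF r]) auto
      then show "norm (\<phi> r * (\<epsilon> * c r)) \<le> C * exp (L\<^sup>2 / (4 * \<delta>))"
        by (simp add: abs_mult \<epsilon>_def mult_ac)
    qed
    then have 1: "\<bar>integral {0..L} (\<lambda>r. \<phi> r * (\<epsilon> * c r))\<bar> \<le> K" using L by (simp add: K_def mult_ac)
    have "norm (integral {0..L} (\<lambda>r. exp (- (real n * (L - r))) * b r)) \<le> integral {0..L} (\<lambda>r. B)"
    proof (rule integral_norm_bound_integral[OF i3 integrable_const_ivl])
      fix r assume r: "r \<in> {0..L}"
      have "exp (- (real n * (L - r))) \<le> 1" using r by simp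
      from mult_mono[OF this B(2)[OF r]] show "norm (exp (- (real n * (L - r))) * b r) \<le> B"
        by (simp add: abs_mult)
    qed
    then have 2: "\<bar>integral {0..L} (\<lambda>r. exp (- (real n * (L - r))) * b r)\<bar> \<le> B * L"
      using L by (simp add: mult_ac)
    have "(\<lambda>r. exp (real n * (L - r)) * b r) = (\<lambda>r. 2 * (\<phi> r * b r) + exp (- (real n * (L - r))) * b r)"
      by (intro ext) (simp add: \<phi>_def sinh_field_def field_simps)
    then have "integral {0..L} (\<lambda>r. exp (real n * (L - r)) * b r)
        = 2 * integral {0..L} (\<lambda>r. \<phi> r * b r) + integral {0..L} (\<lambda>r. exp (- (real n * (L - r))) * b r)"
      using integral_add[OF integrable_on_mult_right[OF i2, of 2] i3] by simp
    moreover have "integral {0..L} (\<lambda>r. \<phi> r * b r) = integral {0..L} (\<lambda>r. \<phi> r * (\<epsilon> * c r)) - real n * V n L"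
      using integral_diff[OF i1 i2] eq by simp
    moreover have "\<bar>real n * V n L\<bar> \<le> real n * C"
      using VL[OF n] by (simp add: abs_mult mult_left_mono)
    ultimately have "\<bar>integral {0..L} (\<lambda>r. exp (real n * (L - r)) * b r)\<bar> \<le> 2 * (real n * C) + 2 * K + B * L"
      using 1 2 by linarith
    also have "\<dots> \<le> 2 * (real n * C) + (2 * K) * real n + (B * L) * real n"
    proof -
      have "k \<le> k * real n" if "0 \<le> k" for k using mult_left_mono[of 1 "real n" k] n that by simp
      from this[of "2 * K"] this[of "B * L"] show ?thesis using K B(1) L by simp
    qed
    finally show "\<bar>integral {0..L} (\<lambda>r. exp (real n * (L - r)) * b r)\<bar> \<le> (2 * C + 2 * K + B * L) * real n"
      by (simp add: algebra_simps)
  qed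
qed

section \<open>Recovering the potential\<close>

text \<open>Second derivatives within [0, L] are unique. Different potentials compare f'' - P f with
  f'' - P' f; zero potentials compare transmuted functions.\<close>

lemma neumann_unique:
  assumes L: "L > 0" and N: "neumann L P f g" "neumann L P' f' g'"
    and eq: "\<And>x. x \<in> {0..L} \<Longrightarrow> f x = f' x" and x: "x \<in> {0..L}"
  shows "g x + P x * f x = g' x + P' x * f' x"
proof -
  have uniq: "d = d'" if "(k has_real_derivative d) (at y within {0..L})"
      "(k' has_real_derivative d') (at y within {0..L})" "\<And>x. x \<in> {0..L} \<Longrightarrow> k x = k' x"
      "y \<in> {0..L}" for k k' d d' y
  proof -
    have "(k' has_real_derivative d) (at y within {0..L})"
      by (rule has_field_derivative_transform_within[OF that(1) zero_less_one that(4)]) (use that in auto)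
    with that(2) show ?thesis
      using vector_derivative_unique_within_closed_interval[of 0 L y k' d d'] L that(4)
      by (simp add: has_real_derivative_iff_has_vector_derivative)
  qed
  obtain f1 where f1: "\<And>x. x \<in> {0..L} \<Longrightarrow> (f has_real_derivative f1 x) (at x within {0..L})"
      "\<And>x. x \<in> {0..L} \<Longrightarrow> (f1 has_real_derivative g x + P x * f x) (at x within {0..L})"
    using N(1) unfolding neumann_def by blast
  obtain f1' where f1': "\<And>x. x \<in> {0..L} \<Longrightarrow> (f' has_real_derivative f1' x) (at x within {0..L})"
      "\<And>x. x \<in> {0..L} \<Longrightarrow> (f1' has_real_derivative g' x + P' x * f' x) (at x within {0..L})"
    using N(2) unfolding neumann_def by blast
  have f1_eq: "f1 y = f1' y" if "y \<in> {0..L}" for y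
    by (rule uniq[OF f1(1) f1'(1) eq]) (use that in auto)
  show ?thesis by (rule uniq[OF f1(2) f1'(2) f1_eq]) (use x in auto)
qed

lemma neumann_cong:
  assumes "neumann L P f g" "\<And>x. x \<in> {0..L} \<Longrightarrow> g x = g' x"
  shows "neumann L P f g'"
  using assms continuous_on_cong[of "{0..L}" "{0..L}" g g'] unfolding neumann_def by simp

lemma neumann_diff:
  assumes "neumann L (\<lambda>_. 0) f g" "neumann L (\<lambda>_. 0) f' g'"
  shows "neumann L (\<lambda>_. 0) (\<lambda>x. f x - f' x) (\<lambda>x. g x - g' x)"
proof -
  obtain f1 where f1: "f1 0 = 0" "\<And>x. x \<in> {0..L} \<Longrightarrow> (f has_real_derivative f1 x) (at x within {0..L})"
      "\<And>x. x \<in> {0..L} \<Longrightarrow> (f1 has_real_derivative g x) (at x within {0..L})"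
    using assms(1) unfolding neumann_def by auto
  obtain f1' where f1': "f1' 0 = 0" "\<And>x. x \<in> {0..L} \<Longrightarrow> (f' has_real_derivative f1' x) (at x within {0..L})"
      "\<And>x. x \<in> {0..L} \<Longrightarrow> (f1' has_real_derivative g' x) (at x within {0..L})"
    using assms(2) unfolding neumann_def by auto
  have "continuous_on {0..L} (\<lambda>x. g x - g' x)"
    using assms unfolding neumann_def by (auto intro: continuous_on_diff)
  then show ?thesis
    unfolding neumann_def
    by (intro conjI exI[of _ "\<lambda>x. f1 x - f1' x"])
      (use f1 f1' in \<open>auto intro!: DERIV_diff\<close>)
qed

lemma Volterra_zero:
  fixes r :: "real \<Rightarrow> real"
  assumes L: "L > 0" and r: "continuous_on {0..L} r" and K: "K \<ge> 0"
    and nonneg: "\<And>x. x \<in> {0..L} \<Longrightarrow> 0 \<le> r x"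
    and le: "\<And>x. x \<in> {0..L} \<Longrightarrow> r x \<le> K * integral {0..x} r" and x: "x \<in> {0..L}"
  shows "r x = 0"
proof -
  \<comment> \<open>With this weight K / k is at most 1/2, so at the maximum point of
    \<open>r x * exp (- k * x)\<close> the inequality forces r to vanish.\<close>
  define k where "k = 2 * K + 1"
  have k: "k > 0" using K by (simp add: k_def)
  have "continuous_on {0..L} (\<lambda>x. r x * exp (- k * x))" by (intro continuous_intros r)
  from continuous_attains_sup[OF compact_Icc _ this] L obtain p where p: "p \<in> {0..L}"
    and max: "\<And>x. x \<in> {0..L} \<Longrightarrow> r x * exp (- k * x) \<le> r p * exp (- k * p)" by auto
  define m where "m = r p * exp (- k * p)"
  have m: "m \<ge> 0" using nonneg[OF p] by (simp add: m_def)
  have rm: "r y \<le> m * exp (k * y)" if "y \<in> {0..L}" for y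
  proof -
    have "r y * exp (- k * y) * exp (k * y) \<le> m * exp (k * y)"
      unfolding m_def by (intro mult_right_mono max that) auto
    then show ?thesis by (simp add: mult.assoc flip: exp_add)
  qed
  have "((\<lambda>s. m * exp (k * s)) has_integral (m / k * exp (k * p) - m / k * exp (k * 0))) {0..p}"
    by (rule fundamental_theorem_of_calculus)
      (use p k in \<open>auto simp flip: has_real_derivative_iff_has_vector_derivative
         intro!: derivative_eq_intros\<close>)
  then have I: "(\<lambda>s. m * exp (k * s)) integrable_on {0..p}"
      "integral {0..p} (\<lambda>s. m * exp (k * s)) \<le> m / k * exp (k * p)"
    using m k by (auto simp: has_integral_iff)
  have "integral {0..p} r \<le> integral {0..p} (\<lambda>s. m * exp (k * s))"
    by (rule integral_le[OF integrable_continuous_real I(1)])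
      (use p rm in \<open>auto intro: continuous_on_subset[OF r]\<close>)
  with I(2) have "K * integral {0..p} r \<le> K * (m / k * exp (k * p))"
    using K by (intro mult_left_mono) auto
  also have "m * exp (k * p) = r p" by (simp add: m_def mult.assoc flip: exp_add)
  then have "K * (m / k * exp (k * p)) = K / k * r p" by (simp add: field_simps)
  finally have "r p \<le> K / k * r p" using le[OF p] by simp
  moreover have "K / k \<le> 1 / 2" using K by (simp add: k_def divide_simps)
  then have "K / k * r p \<le> 1 / 2 * r p" by (rule mult_right_mono) (rule nonneg[OF p])
  ultimately have "r p = 0" using nonneg[OF p] by linarith
  then have "m = 0" by (simp add: m_def)
  with rm[OF x] nonneg[OF x] show ?thesis by simp
qed

lemma transm_determines_potential:
  assumes L: "L > 0" and P: "continuous_on {0..L} P" and Q: "continuous_on {0..L} Q"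
    and N: "neumann L P a g" "neumann L Q a' g'" and aa': "\<And>x. x \<in> {0..L} \<Longrightarrow> a x = a' x"
    and pos: "\<And>x. x \<in> {0..L} \<Longrightarrow> a x > 0"
    and eq: "\<And>x. x \<in> {0..L} \<Longrightarrow> transm L P a x = transm L Q a' x" and x: "x \<in> {0..L}"
  shows "P x = Q x"
proof -
  have g: "continuous_on {0..L} g" using N(1) by (simp add: neumann_def)
  have a: "continuous_on {0..L} a" by (rule neumann_continuous[OF N(1)])
  define h where "h x = (P x - Q x) * a x" for x
  have h: "continuous_on {0..L} h" unfolding h_def by (intro continuous_intros P Q a)
  \<comment> \<open>a and a' have the same second derivative, so g + P a = g' + Q a.\<close>
  have g': "g' y = 1 * g y + 1 * h y" if "y \<in> {0..L}" for y
    using neumann_unique[OF L N aa' that] aa'[OF that] by (simp add: h_def algebra_simps)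
  have X: "transm L P g y - transm L Q g y = transm L Q h y" if y: "y \<in> {0..L}" for y
  proof -
    have "transm L P g y = transm L Q g' y"
      using neumann_unique[OF L neumann_transm[OF L P N(1)] neumann_transm[OF L Q N(2)] eq y] by simp
    also have "\<dots> = transm L Q (\<lambda>x. 1 * g x + 1 * h x) y"
      using transm_cong[OF L g'] by simp
    also have "\<dots> = 1 * transm L Q g y + 1 * transm L Q h y"
      by (rule transm_lin[OF L Q g h]) (use y in auto)
    finally show ?thesis by simp
  qed
  obtain MP where MP: "\<And>x. x \<in> {0..L} \<Longrightarrow> \<bar>P x\<bar> \<le> MP" using continuous_Icc_bounded[OF P] by metis
  obtain MQ where MQ: "\<And>x. x \<in> {0..L} \<Longrightarrow> \<bar>Q x\<bar> \<le> MQ" using continuous_Icc_bounded[OF Q] by metis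
  define M where "M = max MP MQ"
  have M: "\<bar>P x\<bar> \<le> M" "\<bar>Q x\<bar> \<le> M" if "x \<in> {0..L}" for x
    using MP[OF that] MQ[OF that] by (auto simp: M_def)
  have M0: "M \<ge> 0" using M(1)[OF x] by linarith
  obtain B where B: "B \<ge> 0" "\<And>x. x \<in> {0..L} \<Longrightarrow> \<bar>g x\<bar> \<le> B" using continuous_Icc_bounded[OF g] by metis
  obtain A where A: "A \<ge> 0" "\<And>x. x \<in> {0..L} \<Longrightarrow> \<bar>a x\<bar> \<le> A" using continuous_Icc_bounded[OF a] by metis
  define r where "r x = \<bar>P x - Q x\<bar>" for x
  have r: "continuous_on {0..L} r" unfolding r_def by (intro continuous_intros P Q)
  define K1 where "K1 = 4 * L * M * exp ((M + 1) * L)"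
  define K2 where "K2 = 8 * L * B * exp ((M + 1) * L) * exp ((M + 1) * L)"
  have K: "K1 \<ge> 0" "K2 \<ge> 0" using L M0 B(1) by (simp_all add: K1_def K2_def)
  \<comment> \<open>Split h into h - X_Q h and X_Q h = X_P g - X_Q g; each piece is at most a
    multiple of the integral of \<open>\<bar>P - Q\<bar>\<close>.\<close>
  have est: "\<bar>h y\<bar> \<le> (K1 * A + K2) * integral {0..y} r" if y: "y \<in> {0..L}" for y
  proof -
    have sub: "{0..y} \<subseteq> {0..L}" using y by auto
    have "integral {0..y} (\<lambda>x. \<bar>h x\<bar>) \<le> integral {0..y} (\<lambda>x. A * r x)"
    proof (rule integral_le)
      show "(\<lambda>x. \<bar>h x\<bar>) integrable_on {0..y}" "(\<lambda>x. A * r x) integrable_on {0..y}"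
        by (intro integrable_continuous_real continuous_intros continuous_on_subset[OF h sub]
            continuous_on_subset[OF r sub])+
      show "\<bar>h x\<bar> \<le> A * r x" if "x \<in> {0..y}" for x
        using mult_left_mono[OF A(2), of x "r x"] that sub
        by (auto simp: h_def r_def abs_mult mult.commute)
    qed
    then have "integral {0..y} (\<lambda>x. \<bar>h x\<bar>) \<le> A * integral {0..y} r" by simp
    then have "K1 * integral {0..y} (\<lambda>x. \<bar>h x\<bar>) \<le> K1 * (A * integral {0..y} r)"
      by (rule mult_left_mono) (rule K)
    moreover have "\<bar>transm L Q h y - h y\<bar> \<le> K1 * integral {0..y} (\<lambda>x. \<bar>h x\<bar>)"
      unfolding K1_def by (rule transm_minus_id_bound[OF L Q M(2) h y])
    moreover have "\<bar>transm L Q h y\<bar> \<le> K2 * integral {0..y} r"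
      unfolding X[OF y, symmetric] K2_def r_def
      by (rule transm_diff_bound[OF L P M(1) Q M(2) g B(2) y])
    ultimately show ?thesis by (simp add: algebra_simps)
  qed
  \<comment> \<open>The minimum of a is positive, so the bound on \<open>\<bar>h\<bar>\<close>
    becomes a Volterra inequality for \<open>\<bar>P - Q\<bar>\<close> itself.\<close>
  obtain y0 where y0: "y0 \<in> {0..L}" "\<And>y. y \<in> {0..L} \<Longrightarrow> a y0 \<le> a y"
    using continuous_attains_inf[OF compact_Icc _ a] L by auto
  define \<alpha> where "\<alpha> = a y0"
  have \<alpha>: "\<alpha> > 0" using pos[OF y0(1)] by (simp add: \<alpha>_def)
  have "r x = 0"
  proof (rule Volterra_zero[OF L r _ _ _ x])
    show "0 \<le> (K1 * A + K2) / \<alpha>" using K A(1) \<alpha> by simp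
    show "0 \<le> r y" for y by (simp add: r_def)
    show "r y \<le> (K1 * A + K2) / \<alpha> * integral {0..y} r" if y: "y \<in> {0..L}" for y
    proof -
      have "r y * \<alpha> \<le> r y * a y" using y0(2)[OF y] by (simp add: \<alpha>_def r_def mult_left_mono)
      also have "\<dots> = \<bar>h y\<bar>" using pos[OF y] by (simp add: h_def r_def abs_mult)
      also have "\<dots> \<le> (K1 * A + K2) * integral {0..y} r" by (rule est[OF y])
      finally show ?thesis using \<alpha> by (simp add: field_simps)
    qed
  qed
  then show ?thesis by (simp add: r_def)
qed

lemma zero_on_closed_box:
  fixes f :: "real \<Rightarrow> real \<Rightarrow> real"
  assumes "T > 0" "L > 0" "continuous_on ({0..T} \<times> {0..L}) (\<lambda>(t, x). f t x)"
    and "\<And>t x. t \<in> {0<..<T} \<Longrightarrow> x \<in> {0<..<L} \<Longrightarrow> f t x = 0"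
    and "t \<in> {0..T}" "x \<in> {0..L}"
  shows "f t x = 0"
proof -
  have "closure ({0<..<T} \<times> {0<..<L}) = {0..T} \<times> {0..L}"
    using assms(1,2) by (simp add: closure_Times)
  then show ?thesis
    using continuous_constant_on_closure[of "{0<..<T} \<times> {0<..<L}" "\<lambda>(t, x). f t x" 0 "(t, x)"] assms
    by auto
qed

lemma continuous_slices:
  assumes "continuous_on ({0..T} \<times> {0..L}) (\<lambda>(t, x). f t x)"
  shows "t \<in> {0..T} \<Longrightarrow> continuous_on {0..L} (f t)"
    and "x \<in> {0..L} \<Longrightarrow> continuous_on {0..T} (\<lambda>t. f t x)"
proof -
  have "continuous_on {0..L} (\<lambda>x. (\<lambda>(t, x). f t x) (t, x))" if "t \<in> {0..T}"
    by (rule continuous_on_compose2[OF assms]) (use that in \<open>auto intro!: continuous_intros\<close>)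
  then show "t \<in> {0..T} \<Longrightarrow> continuous_on {0..L} (f t)" by simp
  have "continuous_on {0..T} (\<lambda>t. (\<lambda>(t, x). f t x) (t, x))" if "x \<in> {0..L}"
    by (rule continuous_on_compose2[OF assms]) (use that in \<open>auto intro!: continuous_intros\<close>)
  then show "x \<in> {0..L} \<Longrightarrow> continuous_on {0..T} (\<lambda>t. f t x)" by simp
qed

section \<open>The heat equation\<close>

text \<open>Stated on the closed rectangle because the common slice a sits at t = 0 or t = T, where
  the equation is needed too; \<open>heat_solI\<close> gets there by continuity.\<close>

definition heat_sol :: "real \<Rightarrow> real \<Rightarrow> (real \<Rightarrow> real) \<Rightarrow> (real \<Rightarrow> real \<Rightarrow> real) \<Rightarrow> bool" where
  "heat_sol T L P u \<longleftrightarrow> u \<in> C12 T L \<and>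
     (\<forall>t\<in>{0..T}. dx L u t 0 = 0 \<and> (\<forall>x\<in>{0..L}. dt T u t x + P x * u t x = dx L (dx L u) t x))"

lemma heat_solI:
  assumes "L > 0" "T > 0" and P: "continuous_on {0..L} P" and u: "u \<in> C12 T L"
    and pde: "\<And>t x. t \<in> {0<..<T} \<Longrightarrow> x \<in> {0<..<L} \<Longrightarrow> dt T u t x = dx L (dx L u) t x - P x * u t x"
    and bc: "\<And>t. t \<in> {0<..<T} \<Longrightarrow> dx L u t 0 = 0"
  shows "heat_sol T L P u"
proof -
  have c: "continuous_on ({0..T} \<times> {0..L}) (\<lambda>(t, x). u t x)"
    "continuous_on ({0..T} \<times> {0..L}) (\<lambda>(t, x). dt T u t x)"
    "continuous_on ({0..T} \<times> {0..L}) (\<lambda>(t, x). dx L u t x)"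
    "continuous_on ({0..T} \<times> {0..L}) (\<lambda>(t, x). dx L (dx L u) t x)"
    using u by (auto simp: C12_def)
  have "continuous_on ({0..T} \<times> {0..L}) (\<lambda>p. P (snd p))"
    by (rule continuous_on_compose2[OF P]) (auto intro!: continuous_intros)
  with c have "continuous_on ({0..T} \<times> {0..L})
      (\<lambda>p. dt T u (fst p) (snd p) - (dx L (dx L u) (fst p) (snd p) - P (snd p) * u (fst p) (snd p)))"
    by (intro continuous_intros) (simp_all add: case_prod_unfold)
  then have "continuous_on ({0..T} \<times> {0..L}) (\<lambda>(t, x). dt T u t x - (dx L (dx L u) t x - P x * u t x))"
    by (simp add: case_prod_unfold)
  from zero_on_closed_box[OF assms(2,1) this] pde
  have "dt T u t x + P x * u t x = dx L (dx L u) t x" if "t \<in> {0..T}" "x \<in> {0..L}" for t x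
    using that by force
  moreover have "dx L u t 0 = 0" if "t \<in> {0..T}" for t
    by (rule zero_on_closed_Icc[OF assms(2) continuous_slices(2)[OF c(3)] bc that])
      (use assms(1) in auto)
  ultimately show ?thesis using u by (simp add: heat_sol_def)
qed

lemma heat_sol_derivatives:
  assumes "heat_sol T L P u" "t \<in> {0..T}" "x \<in> {0..L}"
  shows "((\<lambda>t. u t x) has_real_derivative dt T u t x) (at t within {0..T})"
    and "(u t has_real_derivative dx L u t x) (at x within {0..L})"
    and "(dx L u t has_real_derivative dt T u t x + P x * u t x) (at x within {0..L})"
  using assms vector_derivative_works[of "\<lambda>s. u s x" "at t within {0..T}"]
    vector_derivative_works[of "u t" "at x within {0..L}"]
    vector_derivative_works[of "dx L u t" "at x within {0..L}"]
  by (auto simp: heat_sol_def C12_def dt_def dx_def[abs_def] has_real_derivative_iff_has_vector_derivative)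

text \<open>The time derivative plays the part of f'' - P f on each slice, the end times included,
  so it provides the function g belonging to a.\<close>

lemma heat_sol_slice:
  assumes "heat_sol T L P u" "t \<in> {0..T}"
  shows "neumann L P (u t) (dt T u t)"
proof -
  have "continuous_on ({0..T} \<times> {0..L}) (\<lambda>(t, x). dt T u t x)"
    using assms(1) by (auto simp: heat_sol_def C12_def)
  from continuous_slices(1)[OF this assms(2)] show ?thesis
    unfolding neumann_def
    using heat_sol_derivatives(2,3)[OF assms] assms by (auto simp: heat_sol_def intro!: exI[of _ "dx L u t"])
qed

text \<open>The exponent is shifted to \<open>t\<^sub>1\<close> so that, after integration by parts,
  the slice at \<open>t\<^sub>1\<close> appears without weight and the one at T with a decaying
  factor.\<close>

definition laplace :: "real \<Rightarrow> real \<Rightarrow> (real \<Rightarrow> real \<Rightarrow> real) \<Rightarrow> real \<Rightarrow> real \<Rightarrow> real" where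
  "laplace t\<^sub>1 T u s x = integral {t\<^sub>1..T} (\<lambda>t. exp (- (s * (t - t\<^sub>1))) * u t x)"

lemma laplace_has_derivative:
  assumes t1: "t\<^sub>1 \<in> {0..T}" and x: "x \<in> {0..L}"
    and w: "continuous_on ({0..T} \<times> {0..L}) (\<lambda>(t, x). w t x)"
    and w': "continuous_on ({0..T} \<times> {0..L}) (\<lambda>(t, x). w' t x)"
    and d: "\<And>t x. t \<in> {0..T} \<Longrightarrow> x \<in> {0..L} \<Longrightarrow> (w t has_real_derivative w' t x) (at x within {0..L})"
  shows "(laplace t\<^sub>1 T w s has_real_derivative laplace t\<^sub>1 T w' s x) (at x within {0..L})"
proof -
  have "((\<lambda>x. integral (cbox t\<^sub>1 T) (\<lambda>t. exp (- (s * (t - t\<^sub>1))) * w t x)) has_real_derivative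
      integral (cbox t\<^sub>1 T) (\<lambda>t. exp (- (s * (t - t\<^sub>1))) * w' t x)) (at x within {0..L})"
  proof (rule leibniz_rule_field_derivative[where U = "{0..L}"])
    show "((\<lambda>x. exp (- (s * (t - t\<^sub>1))) * w t x) has_real_derivative exp (- (s * (t - t\<^sub>1))) * w' t x)
        (at x within {0..L})" if "x \<in> {0..L}" "t \<in> cbox t\<^sub>1 T" for x t
      by (rule DERIV_cmult[OF d]) (use that t1 in auto)
    show "(\<lambda>t. exp (- (s * (t - t\<^sub>1))) * w t x) integrable_on cbox t\<^sub>1 T" if "x \<in> {0..L}" for x
      using continuous_on_subset[OF continuous_slices(2)[OF w that], of "{t\<^sub>1..T}"] t1
      by (auto intro!: integrable_continuous_real continuous_intros)
    have "continuous_on ({0..L} \<times> {t\<^sub>1..T}) (\<lambda>p. (\<lambda>(t, x). w' t x) (snd p, fst p))"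
      by (rule continuous_on_compose2[OF w']) (use t1 in \<open>auto intro!: continuous_intros\<close>)
    then show "continuous_on ({0..L} \<times> cbox t\<^sub>1 T) (\<lambda>(x, t). exp (- (s * (t - t\<^sub>1))) * w' t x)"
      by (auto simp: case_prod_unfold intro!: continuous_intros)
  qed (use x in auto)
  then show ?thesis by (simp add: laplace_def[abs_def])
qed

text \<open>P does not depend on t, so it comes out of the integral; integrating the time derivative
  by parts gives s times the transform and the two end slices.\<close>

lemma laplace_neumann:
  assumes H: "heat_sol T L P u" and t1: "t\<^sub>1 \<in> {0..T}" and L: "L > 0"
  shows "neumann L P (laplace t\<^sub>1 T u s)
    (\<lambda>x. s * laplace t\<^sub>1 T u s x - u t\<^sub>1 x + exp (- (s * (T - t\<^sub>1))) * u T x)"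
proof -
  have c: "continuous_on ({0..T} \<times> {0..L}) (\<lambda>(t, x). u t x)"
    "continuous_on ({0..T} \<times> {0..L}) (\<lambda>(t, x). dt T u t x)"
    "continuous_on ({0..T} \<times> {0..L}) (\<lambda>(t, x). dx L u t x)"
    "continuous_on ({0..T} \<times> {0..L}) (\<lambda>(t, x). dx L (dx L u) t x)"
    using H by (auto simp: heat_sol_def C12_def)
  have T: "T \<in> {0..T}" using t1 by auto
  define e where "e t = exp (- (s * (t - t\<^sub>1)))" for t
  have d1: "(laplace t\<^sub>1 T u s has_real_derivative laplace t\<^sub>1 T (dx L u) s x) (at x within {0..L})"
    if "x \<in> {0..L}" for x
    by (rule laplace_has_derivative[OF t1 that c(1,3)]) (rule heat_sol_derivatives[OF H])
  have d2: "(laplace t\<^sub>1 T (dx L u) s has_real_derivative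
      (s * laplace t\<^sub>1 T u s x - u t\<^sub>1 x + exp (- (s * (T - t\<^sub>1))) * u T x) + P x * laplace t\<^sub>1 T u s x)
      (at x within {0..L})" if x: "x \<in> {0..L}" for x
  proof -
    have dxx: "dx L (dx L u) t y = dt T u t y + P y * u t y" if "t \<in> {0..T}" "y \<in> {0..L}" for t y
      using H that by (simp add: heat_sol_def)
    have "(laplace t\<^sub>1 T (dx L u) s has_real_derivative laplace t\<^sub>1 T (dx L (dx L u)) s x) (at x within {0..L})"
      by (rule laplace_has_derivative[OF t1 x c(3,4)]) (simp add: dxx heat_sol_derivatives[OF H])
    moreover have "laplace t\<^sub>1 T (dx L (dx L u)) s x
        = s * laplace t\<^sub>1 T u s x - u t\<^sub>1 x + e T * u T x + P x * laplace t\<^sub>1 T u s x"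
    proof -
      have sub: "{t\<^sub>1..T} \<subseteq> {0..T}" using t1 by auto
      have cu: "continuous_on {t\<^sub>1..T} (\<lambda>t. u t x)" "continuous_on {t\<^sub>1..T} (\<lambda>t. dt T u t x)"
        by (rule continuous_on_subset[OF continuous_slices(2)[OF c(1) x] sub],
            rule continuous_on_subset[OF continuous_slices(2)[OF c(2) x] sub])
      have ce: "continuous_on {t\<^sub>1..T} e" unfolding e_def by (intro continuous_intros)
      have i: "(\<lambda>t. e t * u t x) integrable_on {t\<^sub>1..T}" "(\<lambda>t. e t * dt T u t x) integrable_on {t\<^sub>1..T}"
        by (intro integrable_continuous_real continuous_intros cu ce)+
      have "((\<lambda>t. e t * dt T u t x - s * (e t * u t x)) has_integral (e T * u T x - e t\<^sub>1 * u t\<^sub>1 x)) {t\<^sub>1..T}"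
      proof (rule fundamental_theorem_of_calculus)
        fix t assume t: "t \<in> {t\<^sub>1..T}"
        have "((\<lambda>t. u t x) has_real_derivative dt T u t x) (at t within {t\<^sub>1..T})"
          by (rule DERIV_subset[OF heat_sol_derivatives(1)[OF H _ x] sub]) (use t sub in auto)
        moreover have "(e has_real_derivative - s * e t) (at t within {t\<^sub>1..T})"
          unfolding e_def by (auto intro!: derivative_eq_intros)
        ultimately have "((\<lambda>t. e t * u t x) has_real_derivative - s * e t * u t x + dt T u t x * e t)
            (at t within {t\<^sub>1..T})"
          by (rule DERIV_mult[rotated])
        then show "((\<lambda>t. e t * u t x) has_vector_derivative e t * dt T u t x - s * (e t * u t x))
            (at t within {t\<^sub>1..T})"
          by (simp add: has_real_derivative_iff_has_vector_derivative algebra_simps)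
      qed (use t1 in auto)
      then have "integral {t\<^sub>1..T} (\<lambda>t. e t * dt T u t x) - s * integral {t\<^sub>1..T} (\<lambda>t. e t * u t x)
          = e T * u T x - u t\<^sub>1 x"
        using integral_diff[OF i(2) integrable_on_mult_right[OF i(1), of s]]
        by (simp add: has_integral_iff e_def)
      moreover have "laplace t\<^sub>1 T (dx L (dx L u)) s x
          = integral {t\<^sub>1..T} (\<lambda>t. e t * dt T u t x + P x * (e t * u t x))"
        unfolding laplace_def e_def
        by (rule integral_cong) (use t1 x in \<open>auto simp: dxx algebra_simps\<close>)
      ultimately show ?thesis
        using integral_add[OF i(2) integrable_on_mult_right[OF i(1), of "P x"]]
        by (simp add: laplace_def flip: e_def)
    qed
    ultimately show ?thesis by (simp add: e_def)
  qed
  have "continuous_on {0..L} (laplace t\<^sub>1 T u s)" by (rule DERIV_continuous_on[OF d1])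
  then have "continuous_on {0..L} (\<lambda>x. s * laplace t\<^sub>1 T u s x - u t\<^sub>1 x + exp (- (s * (T - t\<^sub>1))) * u T x)"
    by (intro continuous_intros continuous_slices(1)[OF c(1)] t1 T)
  moreover have "laplace t\<^sub>1 T (dx L u) s 0 = integral {t\<^sub>1..T} (\<lambda>t. 0)"
    unfolding laplace_def by (rule integral_cong) (use H t1 in \<open>auto simp: heat_sol_def\<close>)
  ultimately show ?thesis
    unfolding neumann_def using d1 d2 by (intro conjI exI[of _ "laplace t\<^sub>1 T (dx L u) s"]) auto
qed

text \<open>The weight is at most 1, so the bound is independent of s; this keeps V bounded as n
  grows.\<close>

lemma laplace_bound:
  assumes t1: "t\<^sub>1 \<in> {0..T}" and s: "s \<ge> 0"
    and u: "continuous_on {0..T} (\<lambda>t. u t x)" "\<And>t. t \<in> {0..T} \<Longrightarrow> \<bar>u t x\<bar> \<le> B"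
  shows "\<bar>laplace t\<^sub>1 T u s x\<bar> \<le> T * B"
proof -
  have B: "B \<ge> 0" using u(2)[OF t1] by linarith
  have sub: "{t\<^sub>1..T} \<subseteq> {0..T}" using t1 by auto
  have "norm (laplace t\<^sub>1 T u s x) \<le> integral {t\<^sub>1..T} (\<lambda>t. B)"
    unfolding laplace_def
  proof (rule integral_norm_bound_integral[OF _ integrable_const_ivl])
    show "(\<lambda>t. exp (- (s * (t - t\<^sub>1))) * u t x) integrable_on {t\<^sub>1..T}"
      by (intro integrable_continuous_real continuous_intros continuous_on_subset[OF u(1) sub])
    fix t assume t: "t \<in> {t\<^sub>1..T}"
    have "exp (- (s * (t - t\<^sub>1))) \<le> 1" using t s by simp
    from mult_mono[OF this u(2)] t sub show "norm (exp (- (s * (t - t\<^sub>1))) * u t x) \<le> B"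
      by (auto simp: abs_mult)
  qed
  also have "\<dots> \<le> T * B" using t1 B by (simp add: mult_right_mono)
  finally show ?thesis by simp
qed

section \<open>Transmuted solutions of the heat equation\<close>

lemma heat_sol_continuous:
  "heat_sol T L P u \<Longrightarrow> continuous_on ({0..T} \<times> {0..L}) (\<lambda>(t, x). u t x)"
  by (auto simp: heat_sol_def C12_def)

lemma heat_sol_bounded:
  assumes "heat_sol T L P u"
  shows "\<exists>B. \<forall>t\<in>{0..T}. \<forall>x\<in>{0..L}. \<bar>u t x\<bar> \<le> B"
proof -
  have "bounded ((\<lambda>(t, x). u t x) ` ({0..T} \<times> {0..L}))"
    by (intro compact_imp_bounded compact_continuous_image heat_sol_continuous[OF assms] compact_Times compact_Icc)
  then show ?thesis by (force simp: bounded_iff)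
qed

text \<open>Linearity and the sup bound \<open>transm_bound\<close> turn uniform continuity of u
  into continuity in t. It serves to pass from interior times to t = 0 and t = T.\<close>

lemma continuous_transm_heat_sol:
  assumes L: "L > 0" and P: "continuous_on {0..L} P" and H: "heat_sol T L P u" and x: "x \<in> {0..L}"
  shows "continuous_on {0..T} (\<lambda>t. transm L P (u t) x)"
proof -
  obtain M where M: "\<And>x. x \<in> {0..L} \<Longrightarrow> \<bar>P x\<bar> \<le> M" using continuous_Icc_bounded[OF P] by metis
  define E where "E = exp ((M + 1) * L)"
  have E: "E > 0" by (simp add: E_def)
  note cu = heat_sol_continuous[OF H]
  have uc: "uniformly_continuous_on ({0..T} \<times> {0..L}) (\<lambda>(t, x). u t x)"
    by (rule compact_uniformly_continuous[OF cu]) (intro compact_Times compact_Icc)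
  show ?thesis
    unfolding continuous_on_iff
  proof (intro ballI allI impI)
    fix t e :: real assume t: "t \<in> {0..T}" and e: "e > 0"
    \<comment> \<open>\<open>transm_bound\<close> multiplies by 2 E, so this choice leaves e /
      2.\<close>
    have "e / (4 * E) > 0" using e E by simp
    with uc obtain d where d: "d > 0" "\<And>p q. p \<in> {0..T} \<times> {0..L} \<Longrightarrow> q \<in> {0..T} \<times> {0..L} \<Longrightarrow>
        dist q p < d \<Longrightarrow> dist ((\<lambda>(t, x). u t x) q) ((\<lambda>(t, x). u t x) p) < e / (4 * E)"
      unfolding uniformly_continuous_on_def by metis
    show "\<exists>d>0. \<forall>t'\<in>{0..T}. dist t' t < d \<longrightarrow> dist (transm L P (u t') x) (transm L P (u t) x) < e"
    proof (intro exI[of _ d] conjI ballI impI d(1))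
      fix t' assume t': "t' \<in> {0..T}" "dist t' t < d"
      note c = continuous_slices(1)[OF cu t'(1)] continuous_slices(1)[OF cu t]
      have "\<bar>transm L P (\<lambda>y. 1 * u t' y + (- 1) * u t y) x\<bar> \<le> 2 * (e / (4 * E)) * exp ((M + 1) * L)"
      proof (rule transm_bound[OF L P _ M _ x])
        show "continuous_on {0..L} (\<lambda>y. 1 * u t' y + (- 1) * u t y)" by (intro continuous_intros c)
        show "\<bar>1 * u t' y + (- 1) * u t y\<bar> \<le> e / (4 * E)" if "y \<in> {0..L}" for y
          using d(2)[of "(t, y)" "(t', y)"] t t' that by (simp add: dist_Pair_Pair dist_real_def)
      qed
      also have "transm L P (\<lambda>y. 1 * u t' y + (- 1) * u t y) x = 1 * transm L P (u t') x + (- 1) * transm L P (u t) x"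
        by (rule transm_lin[OF L P c]) (use x in auto)
      finally have "\<bar>transm L P (u t') x - transm L P (u t) x\<bar> \<le> e / 2"
        using E by (simp flip: E_def)
      then show "dist (transm L P (u t') x) (transm L P (u t) x) < e"
        using e by (simp add: dist_real_def)
    qed
  qed
qed

text \<open>Applying X_P to the transform, not the transform to X_P u, avoids both a time derivative
  of X_P u and an exchange of X_P with the time integral.\<close>

lemma neumann_transm_laplace:
  assumes L: "L > 0" and P: "continuous_on {0..L} P" and H: "heat_sol T L P u" and t1: "t\<^sub>1 \<in> {0..T}"
  shows "neumann L (\<lambda>_. 0) (transm L P (laplace t\<^sub>1 T u s)) (\<lambda>x. s * transm L P (laplace t\<^sub>1 T u s) x
    - transm L P (u t\<^sub>1) x + exp (- (s * (T - t\<^sub>1))) * transm L P (u T) x)"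
proof (rule neumann_cong[OF neumann_transm[OF L P laplace_neumann[OF H t1 L, of s]]])
  fix x assume x: "x \<in> {0..L}"
  have T: "T \<in> {0..T}" using t1 by auto
  note cu = continuous_slices(1)[OF heat_sol_continuous[OF H]]
  note cl = neumann_continuous[OF laplace_neumann[OF H t1 L, of s]]
  define e where "e = exp (- (s * (T - t\<^sub>1)))"
  define w where "w x = s * laplace t\<^sub>1 T u s x + (- 1) * u t\<^sub>1 x" for x
  have w: "continuous_on {0..L} w" unfolding w_def by (intro continuous_intros cl cu t1)
  have "(\<lambda>x. s * laplace t\<^sub>1 T u s x - u t\<^sub>1 x + e * u T x) = (\<lambda>x. 1 * w x + e * u T x)"
    by (simp add: w_def)
  then have "transm L P (\<lambda>x. s * laplace t\<^sub>1 T u s x - u t\<^sub>1 x + e * u T x) x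
      = 1 * transm L P w x + e * transm L P (u T) x"
    using transm_lin[OF L P w cu[OF T], of x 1 e] x by simp
  also have "transm L P w x = s * transm L P (laplace t\<^sub>1 T u s) x + (- 1) * transm L P (u t\<^sub>1) x"
    unfolding w_def by (rule transm_lin[OF L P cl cu[OF t1]]) (use x in auto)
  finally show "transm L P (\<lambda>x. s * laplace t\<^sub>1 T u s x - u t\<^sub>1 x + exp (- (s * (T - t\<^sub>1))) * u T x) x
      = s * transm L P (laplace t\<^sub>1 T u s) x - transm L P (u t\<^sub>1) x
        + exp (- (s * (T - t\<^sub>1))) * transm L P (u T) x"
    by (simp add: e_def)
qed

lemma transm_heat_sol_eq:
  assumes L: "L > 0" and T: "T > 0" and P: "continuous_on {0..L} P" and Q: "continuous_on {0..L} Q"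
    and H: "heat_sol T L P u" "heat_sol T L Q v"
    and eq: "\<And>t. t \<in> {0..T} \<Longrightarrow> u t 0 = v t 0" and t: "t \<in> {0..T}" and x: "x \<in> {0..L}"
  shows "transm L P (u t) x = transm L Q (v t) x"
proof -
  note cu = continuous_slices[OF heat_sol_continuous[OF H(1)]]
  note cv = continuous_slices[OF heat_sol_continuous[OF H(2)]]
  have TT: "T \<in> {0..T}" using T by auto
  obtain B1 where B1: "\<And>t x. t \<in> {0..T} \<Longrightarrow> x \<in> {0..L} \<Longrightarrow> \<bar>u t x\<bar> \<le> B1"
    using heat_sol_bounded[OF H(1)] by metis
  obtain B2 where B2: "\<And>t x. t \<in> {0..T} \<Longrightarrow> x \<in> {0..L} \<Longrightarrow> \<bar>v t x\<bar> \<le> B2"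
    using heat_sol_bounded[OF H(2)] by metis
  obtain M1 where M1: "\<And>x. x \<in> {0..L} \<Longrightarrow> \<bar>P x\<bar> \<le> M1" using continuous_Icc_bounded[OF P] by metis
  obtain M2 where M2: "\<And>x. x \<in> {0..L} \<Longrightarrow> \<bar>Q x\<bar> \<le> M2" using continuous_Icc_bounded[OF Q] by metis
  define C1 where "C1 = 2 * (T * B1) * exp ((M1 + 1) * L) + 2 * (T * B2) * exp ((M2 + 1) * L)"
  define c where "c x = transm L P (u T) x - transm L Q (v T) x" for x
  have cc: "continuous_on {0..L} c"
    unfolding c_def by (intro continuous_intros continuous_transm L P Q cu cv TT)
  obtain C2 where C2: "\<And>x. x \<in> {0..L} \<Longrightarrow> \<bar>c x\<bar> \<le> C2" using continuous_Icc_bounded[OF cc] by metis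
  \<comment> \<open>Below T the decay rate T - \<open>t\<^sub>1\<close> is positive, as
    \<open>resolvent_bounded_zero\<close> demands; the end times follow by continuity.\<close>
  have interior: "transm L P (u t\<^sub>1) x - transm L Q (v t\<^sub>1) x = 0" if "t\<^sub>1 \<in> {0<..<T}" for t\<^sub>1
  proof -
    have t1: "t\<^sub>1 \<in> {0..T}" "T - t\<^sub>1 > 0" using that by auto
    define U where "U n = laplace t\<^sub>1 T u ((real n)\<^sup>2)" for n
    define W where "W n = laplace t\<^sub>1 T v ((real n)\<^sup>2)" for n
    define V where "V n x = transm L P (U n) x - transm L Q (W n) x" for n x
    have cU: "continuous_on {0..L} (U n)" "continuous_on {0..L} (W n)" for n
      unfolding U_def W_def
      using neumann_continuous[OF laplace_neumann[OF H(1) t1(1) L]]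
        neumann_continuous[OF laplace_neumann[OF H(2) t1(1) L]] by auto
    show ?thesis
    proof (rule resolvent_bounded_zero[where V = V and C = "max C1 C2"
          and b = "\<lambda>x. transm L P (u t\<^sub>1) x - transm L Q (v t\<^sub>1) x", OF L t1(2) _ cc])
      show "continuous_on {0..L} (\<lambda>x. transm L P (u t\<^sub>1) x - transm L Q (v t\<^sub>1) x)"
        by (intro continuous_intros continuous_transm L P Q cu cv t1)
      show "\<bar>c y\<bar> \<le> max C1 C2" if "y \<in> {0..L}" for y using C2[OF that] by simp
      show "neumann L (\<lambda>_. 0) (V n) (\<lambda>x. (real n)\<^sup>2 * V n x
          - (transm L P (u t\<^sub>1) x - transm L Q (v t\<^sub>1) x) + exp (- ((real n)\<^sup>2 * (T - t\<^sub>1))) * c x)" for n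
        unfolding V_def[abs_def]
        by (rule neumann_cong[OF neumann_diff[OF neumann_transm_laplace[OF L P H(1) t1(1), of "(real n)\<^sup>2", folded U_def]
            neumann_transm_laplace[OF L Q H(2) t1(1), of "(real n)\<^sup>2", folded W_def]]])
          (simp add: c_def algebra_simps)
      \<comment> \<open>The equality of u and v at x = 0 enters here; the other Cauchy datum, a
        vanishing derivative, is part of \<open>neumann\<close>.\<close>
      show "V n 0 = 0" for n
      proof -
        have "U n 0 = W n 0"
          unfolding U_def W_def laplace_def by (rule integral_cong) (use eq t1 in auto)
        then show ?thesis by (simp add: V_def transm_0[OF L P cU(1)] transm_0[OF L Q cU(2)])
      qed
      show "\<bar>V n L\<bar> \<le> max C1 C2" for n
      proof -
        have "\<bar>U n y\<bar> \<le> T * B1" "\<bar>W n y\<bar> \<le> T * B2" if "y \<in> {0..L}" for y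
          unfolding U_def W_def
          using laplace_bound[where u = u, OF t1(1) zero_le_power2 cu(2)[OF that] B1[OF _ that]]
            laplace_bound[where u = v, OF t1(1) zero_le_power2 cv(2)[OF that] B2[OF _ that]] by auto
        from transm_bound[OF L P cU(1) M1 this(1)] transm_bound[OF L Q cU(2) M2 this(2)]
        have "\<bar>transm L P (U n) L\<bar> \<le> 2 * (T * B1) * exp ((M1 + 1) * L)"
          "\<bar>transm L Q (W n) L\<bar> \<le> 2 * (T * B2) * exp ((M2 + 1) * L)"
          using L by auto
        then show ?thesis by (simp add: V_def C1_def)
      qed
    qed fact
  qed
  have "continuous_on {0..T} (\<lambda>t. transm L P (u t) x - transm L Q (v t) x)"
    by (intro continuous_intros continuous_transm_heat_sol L P Q H x)
  from zero_on_closed_Icc[OF T this interior t] show ?thesis by simp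
qed

theorem corollary2:
  fixes L T :: real
    and P Q :: "real \<Rightarrow> real"
    and u v :: "real \<Rightarrow> real \<Rightarrow> real"
  assumes "L > 0" and "T > 0"
    and "P \<in> C1_on {0..L}" and "Q \<in> C1_on {0..L}"
    and "u \<in> C12 T L" and "v \<in> C12 T L"
    and "\<And>t x. t \<in> {0<..<T} \<Longrightarrow> x \<in> {0<..<L} \<Longrightarrow> dt T u t x = dx L (dx L u) t x - P x * u t x"
    and "\<And>t. t \<in> {0<..<T} \<Longrightarrow> dx L u t 0 = 0"
    and "\<And>t x. t \<in> {0<..<T} \<Longrightarrow> x \<in> {0<..<L} \<Longrightarrow> dt T v t x = dx L (dx L v) t x - Q x * v t x"
    and "\<And>t. t \<in> {0<..<T} \<Longrightarrow> dx L v t 0 = 0"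
    and "\<exists>a\<in>A_class L. (\<forall>x\<in>{0..L}. u 0 x = a x \<and> v 0 x = a x) \<or>
                       (\<forall>x\<in>{0..L}. u T x = a x \<and> v T x = a x)"
    and "\<And>t. t \<in> {0<..<T} \<Longrightarrow> u t 0 = v t 0"
  shows "\<forall>x\<in>{0..L}. P x = Q x"
proof -
  have P: "continuous_on {0..L} P" and Q: "continuous_on {0..L} Q"
    using assms(3,4)
    by (auto simp: C1_on_def continuous_on_eq_continuous_within intro: differentiable_imp_continuous_within)
  have H: "heat_sol T L P u" "heat_sol T L Q v"
    by (rule heat_solI[OF assms(1,2) P assms(5,7,8)], assumption+)
      (rule heat_solI[OF assms(1,2) Q assms(6,9,10)], assumption+)
  have zero: "0 \<in> {0..L}" using assms(1) by auto
  have "continuous_on {0..T} (\<lambda>t. u t 0 - v t 0)"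
    using continuous_slices(2)[OF heat_sol_continuous[OF H(1)] zero]
      continuous_slices(2)[OF heat_sol_continuous[OF H(2)] zero] by (rule continuous_on_diff)
  then have bdry: "u t 0 = v t 0" if "t \<in> {0..T}" for t
    using zero_on_closed_Icc[OF assms(2) _ _ that, of "\<lambda>t. u t 0 - v t 0"] assms(12) by simp
  \<comment> \<open>t is 0 or T, whichever alternative holds; both work because the transmuted
    solutions agree on all of [0, T].\<close>
  obtain t where t: "t \<in> {0..T}" and pos: "\<And>x. x \<in> {0..L} \<Longrightarrow> u t x = v t x \<and> u t x > 0"
  proof -
    obtain a where a: "\<And>x. x \<in> {0..L} \<Longrightarrow> a x > 0"
        "(\<forall>x\<in>{0..L}. u 0 x = a x \<and> v 0 x = a x) \<or> (\<forall>x\<in>{0..L}. u T x = a x \<and> v T x = a x)"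
      using assms(11) unfolding A_class_def by blast
    show thesis using a that[of 0] that[of T] assms(2) by auto
  qed
  have X: "transm L P (u t) x = transm L Q (v t) x" if "x \<in> {0..L}" for x
    by (rule transm_heat_sol_eq[OF assms(1,2) P Q H bdry t that])
  have "P x = Q x" if "x \<in> {0..L}" for x
    by (rule transm_determines_potential[OF assms(1) P Q heat_sol_slice[OF H(1) t]
          heat_sol_slice[OF H(2) t] _ _ X that]) (use pos in blast)+
  then show ?thesis by blast
qed

end
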